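(* Let $S:[0,1)\to[0,1)$ be an interval translation map, let $\mu^*$ be its maximal measure and $\mu_{na}$ its maximal non-atomic measure. Then the support of any invariant measure of $S$ is a subset of the support of $\mu^*$. A similar statement is true for non-atomic measures: the support of any non-atomic invariant measure of $S$ is a subset of the support of $\mu_{na}$.
   Context: An interval translation map (ITM) of $n$ intervals is a map $S:[0,1)\to[0,1)$ determined by $0=t_0<t_1<\dots<t_n=1$ and real numbers $c_1,\dots,c_n$ with $0\le t_{k-1}+c_k<t_k+c_k\le 1$, via $S(t)=t+c_k$ for $t\in[t_{k-1},t_k)$. Invariant measures are Borel probability measures invariant under $S$. It is known that an ITM of $n$ intervals has at most $n$ non-atomic ergodic invariant measures; let $\{\mu_1,\dots,\mu_k\}$, $k\le n$, be the set of all ergodic non-atomic invariant probability measures of $S$ (if any). A non-empty segment (or interval) $J$ is called rigid with respect to $S$ if the restriction $S^m|_J$ is continuous for all $m\in\mathbb{N}$; it is stated as well known that all points of a rigid segment are periodic. Let $\mu_{per}$ be the probability (normalized) Lebesgue measure on the union of the rigid segments (if any). The maximal non-atomic measure is $\mu_{na}:=\frac1k\sum_{j=1}^k\mu_j$. Each of $\mu_{na}$, $\mu_{per}$ is set to zero if the corresponding set (of non-atomic ergodic measures, respectively of rigid segments) is empty. The maximal measure is $\mu^*:=\frac{\mu_{na}+\mu_{per}}{2}$ if the set of periodic points of $S$ is non-empty, and $\mu^*:=\mu_{na}$ otherwise.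
   Formalization: The second claim is proved only for non-atomic invariant measures giving zero mass to the periodic points of S; without this it is false (S = identity, Lebesgue measure, where the maximal non-atomic measure is zero). Rigid segments are taken to be nondegenerate intervals. *)

theory Defs
  imports "HOL-Probability.Probability"
begin

section \<open>Interval translation maps\<close>

text \<open>
  A map of the half-open unit interval is a function on the reals; only its values on
  \<open>{0..<1}\<close> are constrained, and every notion below depends only on those values.
\<close>

definition interval_translation_map ::
  "nat \<Rightarrow> (nat \<Rightarrow> real) \<Rightarrow> (nat \<Rightarrow> real) \<Rightarrow> (real \<Rightarrow> real) \<Rightarrow> bool" where
  "interval_translation_map n t c S \<longleftrightarrow>
     t 0 = 0 \<and> t n = 1 \<and>
     (\<forall>k\<in>{1..n}. t (k - 1) < t k \<and> 0 \<le> t (k - 1) + c k \<and> t k + c k \<le> 1 \<and>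
        (\<forall>x\<in>{t (k - 1)..<t k}. S x = x + c k))"

definition periodic_points :: "(real \<Rightarrow> real) \<Rightarrow> real set" where
  "periodic_points S = {x \<in> {0..<1}. \<exists>m\<ge>1. (S ^^ m) x = x}"

text \<open>
  One-point sets are excluded: iterates are trivially continuous on them, so admitting them
  would make every point of \<open>{0..<1}\<close> belong to a rigid segment.
\<close>

definition rigid_segment :: "(real \<Rightarrow> real) \<Rightarrow> real set \<Rightarrow> bool" where
  "rigid_segment S J \<longleftrightarrow>
     is_interval J \<and> J \<subseteq> {0..<1} \<and> (\<exists>a\<in>J. \<exists>b\<in>J. a < b) \<and>
     (\<forall>m. continuous_on J (S ^^ m))"

section \<open>Invariant measures\<close>

abbreviation unit_borel :: "real measure" where
  "unit_borel \<equiv> restrict_space borel {0..<1}"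

definition invariant_measure :: "(real \<Rightarrow> real) \<Rightarrow> real measure \<Rightarrow> bool" where
  "invariant_measure S \<mu> \<longleftrightarrow>
     prob_space \<mu> \<and> sets \<mu> = sets unit_borel \<and> S \<in> measurable \<mu> \<mu> \<and> distr \<mu> \<mu> S = \<mu>"

definition ergodic_measure :: "(real \<Rightarrow> real) \<Rightarrow> real measure \<Rightarrow> bool" where
  "ergodic_measure S \<mu> \<longleftrightarrow>
     invariant_measure S \<mu> \<and>
     (\<forall>A\<in>sets \<mu>. S -` A \<inter> space \<mu> = A \<longrightarrow> emeasure \<mu> A = 0 \<or> emeasure \<mu> A = 1)"

definition atom_of :: "'a measure \<Rightarrow> 'a set \<Rightarrow> bool" where
  "atom_of \<mu> A \<longleftrightarrow>
     A \<in> sets \<mu> \<and> emeasure \<mu> A > 0 \<and>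
     (\<forall>B\<in>sets \<mu>. B \<subseteq> A \<longrightarrow> emeasure \<mu> B = 0 \<or> emeasure \<mu> (A - B) = 0)"

definition nonatomic_measure :: "'a measure \<Rightarrow> bool" where
  "nonatomic_measure \<mu> \<longleftrightarrow> (\<nexists>A. atom_of \<mu> A)"

definition measure_support :: "'a::topological_space measure \<Rightarrow> 'a set" where
  "measure_support \<mu> =
     {x \<in> space \<mu>. \<forall>U. open U \<longrightarrow> x \<in> U \<longrightarrow> emeasure \<mu> (U \<inter> space \<mu>) > 0}"

section \<open>The maximal measures\<close>

definition nonatomic_ergodic_measures :: "(real \<Rightarrow> real) \<Rightarrow> real measure set" where
  "nonatomic_ergodic_measures S = {\<mu>. ergodic_measure S \<mu> \<and> nonatomic_measure \<mu>}"

text \<open>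
  For an interval translation map of \<open>n\<close> intervals the set of non-atomic ergodic measures has
  at most \<open>n\<close> elements, so the sum below is a genuine finite sum.
\<close>

definition maximal_nonatomic_measure :: "(real \<Rightarrow> real) \<Rightarrow> real measure" where
  "maximal_nonatomic_measure S =
     (if nonatomic_ergodic_measures S = {} then null_measure unit_borel
      else measure_of {0..<1} (sets unit_borel)
        (\<lambda>A. (\<Sum>\<mu>\<in>nonatomic_ergodic_measures S. emeasure \<mu> A)
               / of_nat (card (nonatomic_ergodic_measures S))))"

definition periodic_measure :: "(real \<Rightarrow> real) \<Rightarrow> real measure" where
  "periodic_measure S =
     (if \<nexists>J. rigid_segment S J then null_measure unit_borel
      else uniform_measure (restrict_space lborel {0..<1}) (\<Union>{J. rigid_segment S J}))"

definition maximal_measure :: "(real \<Rightarrow> real) \<Rightarrow> real measure" where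
  "maximal_measure S =
     (if periodic_points S \<noteq> {}
      then measure_of {0..<1} (sets unit_borel)
        (\<lambda>A. (emeasure (maximal_nonatomic_measure S) A + emeasure (periodic_measure S) A) / 2)
      else maximal_nonatomic_measure S)"

section \<open>Sanity checks for the definitions\<close>

lemma sigma_algebra_unit_borel: "sigma_algebra {0..<1} (sets unit_borel)"
  using sets.sigma_algebra_axioms[of unit_borel] by (simp add: space_restrict_space)

lemma space_eq_if_sets_unit_borel:
  assumes "sets \<mu> = sets unit_borel"
  shows "space \<mu> = {0..<1}"
  using sets_eq_imp_space_eq[OF assms] by (simp add: space_restrict_space)

lemma sets_maximal_nonatomic_measure [simp]:
  "sets (maximal_nonatomic_measure S) = sets unit_borel"
  by (simp add: maximal_nonatomic_measure_def sigma_algebra.sets_measure_of_eq[OF sigma_algebra_unit_borel])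

lemma sets_periodic_measure [simp]:
  "sets (periodic_measure S) = sets unit_borel"
proof -
  have "sets (restrict_space lborel {0..<1::real}) = sets unit_borel"
    by (rule sets_restrict_space_cong) simp
  then show ?thesis by (simp add: periodic_measure_def)
qed

lemma sets_maximal_measure [simp]:
  "sets (maximal_measure S) = sets unit_borel"
  by (simp add: maximal_measure_def sigma_algebra.sets_measure_of_eq[OF sigma_algebra_unit_borel])

lemma emeasure_maximal_nonatomic_measure:
  assumes "A \<in> sets unit_borel"
  shows "emeasure (maximal_nonatomic_measure S) A =
    (\<Sum>\<mu>\<in>nonatomic_ergodic_measures S. emeasure \<mu> A) / of_nat (card (nonatomic_ergodic_measures S))"
proof (cases "nonatomic_ergodic_measures S = {}")
  case True
  then show ?thesis by (simp add: maximal_nonatomic_measure_def)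
next
  case False
  let ?E = "nonatomic_ergodic_measures S"
  let ?f = "\<lambda>A. (\<Sum>\<mu>\<in>?E. emeasure \<mu> A) / of_nat (card ?E)"
  have E: "sets \<mu> = sets unit_borel" if "\<mu> \<in> ?E" for \<mu>
    using that by (simp add: nonatomic_ergodic_measures_def ergodic_measure_def invariant_measure_def)
  have "countably_additive (sets unit_borel) ?f"
  proof (rule countably_additiveI)
    fix F :: "nat \<Rightarrow> real set"
    assume F: "range F \<subseteq> sets unit_borel" "disjoint_family F"
    have "(\<Sum>i. ?f (F i)) = (\<Sum>i. \<Sum>\<mu>\<in>?E. emeasure \<mu> (F i)) / of_nat (card ?E)"
      by simp
    also have "(\<Sum>i. \<Sum>\<mu>\<in>?E. emeasure \<mu> (F i)) = (\<Sum>\<mu>\<in>?E. \<Sum>i. emeasure \<mu> (F i))"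
      by (rule suminf_sum) auto
    also have "\<dots> = (\<Sum>\<mu>\<in>?E. emeasure \<mu> (\<Union>i. F i))"
      by (intro sum.cong refl suminf_emeasure) (use F E in auto)
    finally show "(\<Sum>i. ?f (F i)) = ?f (\<Union>i. F i)" .
  qed
  moreover have "positive (sets unit_borel) ?f"
    by (simp add: positive_def)
  ultimately show ?thesis
    using False assms
    by (simp add: maximal_nonatomic_measure_def emeasure_measure_of_sigma[OF sigma_algebra_unit_borel])
qed

lemma emeasure_maximal_measure:
  assumes "A \<in> sets unit_borel" "periodic_points S \<noteq> {}"
  shows "emeasure (maximal_measure S) A =
    (emeasure (maximal_nonatomic_measure S) A + emeasure (periodic_measure S) A) / 2"
proof -
  let ?f = "\<lambda>A. (emeasure (maximal_nonatomic_measure S) A + emeasure (periodic_measure S) A) / 2"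
  have "countably_additive (sets unit_borel) ?f"
  proof (rule countably_additiveI)
    fix F :: "nat \<Rightarrow> real set"
    assume F: "range F \<subseteq> sets unit_borel" "disjoint_family F"
    have "(\<Sum>i. ?f (F i)) = (\<Sum>i. emeasure (maximal_nonatomic_measure S) (F i)
        + emeasure (periodic_measure S) (F i)) / 2"
      by simp
    also have "\<dots> = ((\<Sum>i. emeasure (maximal_nonatomic_measure S) (F i))
        + (\<Sum>i. emeasure (periodic_measure S) (F i))) / 2"
      by (simp add: suminf_add[symmetric])
    also have "\<dots> = ?f (\<Union>i. F i)"
      using F by (simp add: suminf_emeasure)
    finally show "(\<Sum>i. ?f (F i)) = ?f (\<Union>i. F i)" .
  qed
  moreover have "positive (sets unit_borel) ?f"
    by (simp add: positive_def)
  ultimately show ?thesis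
    using assms
    by (simp add: maximal_measure_def emeasure_measure_of_sigma[OF sigma_algebra_unit_borel])
qed

section \<open>Non-atomic invariant measures on periodic points\<close>

text \<open>
  A non-atomic invariant measure may charge the periodic points, in which case its ergodic
  components there are atomic. Its support then need not lie in the support of
  \<open>maximal_nonatomic_measure\<close>: for the identity every ergodic measure is a point mass,
  while Lebesgue measure is invariant and non-atomic. The comparison of supports is therefore
  meant for non-atomic measures that do not charge the periodic points.
\<close>

lemma nonatomic_lebesgue: "nonatomic_measure (restrict_space lborel {0..<1::real})"
  unfolding nonatomic_measure_def
proof
  let ?L = "restrict_space lborel {0..<1::real}"
  assume "\<exists>A. atom_of ?L A"
  then obtain A where A: "A \<in> sets ?L" "emeasure ?L A > 0"
    and atom: "\<And>B. B \<in> sets ?L \<Longrightarrow> B \<subseteq> A \<Longrightarrow> emeasure ?L B = 0 \<or> emeasure ?L (A - B) = 0"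
    unfolding atom_of_def by blast
  have em: "emeasure ?L B = emeasure lborel B" if "B \<subseteq> {0..<1}" for B
    using that by (simp add: emeasure_restrict_space)
  have A01: "A \<subseteq> {0..<1}"
    using sets.sets_into_space[OF A(1)] by (simp add: space_restrict_space)
  have Ab: "A \<in> sets borel"
    using A(1) by (simp add: sets_restrict_space_iff)
  have "emeasure lborel A \<le> emeasure lborel {0..<1::real}"
    by (rule emeasure_mono[OF A01]) simp
  then have fin: "emeasure lborel A \<noteq> \<infinity>"
    by (auto simp: top_unique)
  define m where "m = measure lborel A"
  have mA: "emeasure lborel A = ennreal m"
    using fin by (simp add: m_def emeasure_eq_ennreal_measure)
  have m0: "m > 0"
    using A(2) mA em[OF A01] by simp
  obtain N :: nat where N: "N > 0" "1 / real N < m"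
    using reals_Archimedean[OF m0] by (metis inverse_eq_divide zero_less_Suc)
  define P where "P i = A \<inter> {real i / N ..< (real i + 1) / N}" for i :: nat
  have Pb: "P i \<in> sets borel" and PA: "P i \<subseteq> A" for i
    using Ab by (auto simp: P_def)
  have PL: "P i \<in> sets ?L" for i
    using Pb PA A01 by (force simp: sets_restrict_space_iff)
  have null: "emeasure lborel (P i) = 0" for i
  proof (rule ccontr)
    assume "emeasure lborel (P i) \<noteq> 0"
    then have "emeasure ?L (P i) \<noteq> 0" using em PA A01 by (metis order_trans)
    then have "emeasure ?L (A - P i) = 0" using atom[OF PL PA] by blast
    then have 0: "emeasure lborel (A - P i) = 0" using em[of "A - P i"] A01 by auto
    have "emeasure lborel A = emeasure lborel (P i) + emeasure lborel (A - P i)"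
      using plus_emeasure[of "P i" lborel "A - P i"] Pb[of i] Ab PA[of i]
      by (simp add: Un_absorb1)
    also have "\<dots> \<le> emeasure lborel {real i / N ..< (real i + 1) / N}"
      unfolding 0 by (auto simp: P_def intro!: emeasure_mono)
    also have "\<dots> = ennreal (1 / N)"
      using N(1) by (subst emeasure_lborel_Ico) (auto simp: field_simps)
    finally have "m \<le> 1 / N"
      using mA by (simp add: ennreal_le_iff)
    then show False using N(2) by simp
  qed
  have "A \<subseteq> (\<Union>i. P i)"
  proof
    fix x assume x: "x \<in> A"
    then have "x \<ge> 0" using A01 by auto
    then have "real (nat \<lfloor>x * N\<rfloor>) \<le> x * N" "x * N < real (nat \<lfloor>x * N\<rfloor>) + 1"
      by (simp, linarith)
    then have "x \<in> P (nat \<lfloor>x * N\<rfloor>)"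
      using x N(1) by (auto simp: P_def field_simps)
    then show "x \<in> (\<Union>i. P i)" by blast
  qed
  moreover have "emeasure lborel (\<Union>i. P i) = 0"
    using null Pb by (intro emeasure_UN_eq_0) auto
  moreover have "(\<Union>i. P i) \<in> sets borel"
    using Pb by blast
  ultimately have "emeasure lborel A = 0"
    using emeasure_mono[of A "\<Union>i. P i" lborel] by simp
  then show False
    using A(2) em[OF A01] by simp
qed

lemma identity_counterexample:
  defines "L \<equiv> restrict_space lborel {0..<1::real}"
  shows "interval_translation_map 1 real (\<lambda>_. 0) (\<lambda>x. x)"
    and "invariant_measure (\<lambda>x. x) L" and "nonatomic_measure L"
    and "\<not> measure_support L \<subseteq> measure_support (maximal_nonatomic_measure (\<lambda>x. x))"
proof -
  show "interval_translation_map 1 real (\<lambda>_. 0) (\<lambda>x. x)"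
    by (simp add: interval_translation_map_def)
  show "nonatomic_measure L"
    unfolding L_def by (rule nonatomic_lebesgue)
  have setsL: "sets L = sets unit_borel"
    unfolding L_def by (rule sets_restrict_space_cong) simp
  have "prob_space L"
    unfolding L_def by (rule prob_spaceI) (simp add: space_restrict_space emeasure_restrict_space)
  then show "invariant_measure (\<lambda>x. x) L"
    using setsL by (simp add: invariant_measure_def distr_id2)
  have "nonatomic_ergodic_measures (\<lambda>x. x) = {}"
  proof -
    have "atom_of \<mu> (space \<mu>)" if "ergodic_measure (\<lambda>x. x) \<mu>" for \<mu>
    proof -
      interpret prob_space \<mu>
        using that by (simp add: ergodic_measure_def invariant_measure_def)
      have "emeasure \<mu> B = 0 \<or> emeasure \<mu> B = 1" if "B \<in> sets \<mu>" for B
        using \<open>ergodic_measure (\<lambda>x. x) \<mu>\<close> that sets.sets_into_space[OF that]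
        by (simp add: ergodic_measure_def Int_absorb2)
      then have "emeasure \<mu> B = 0 \<or> emeasure \<mu> (space \<mu> - B) = 0" if "B \<in> sets \<mu>" for B
        using that emeasure_compl[OF that] by (fastforce simp: emeasure_space_1)
      then show ?thesis
        by (simp add: atom_of_def emeasure_space_1)
    qed
    then show ?thesis
      by (auto simp: nonatomic_ergodic_measures_def nonatomic_measure_def)
  qed
  then have "measure_support (maximal_nonatomic_measure (\<lambda>x. x)) = {}"
    by (auto simp: measure_support_def maximal_nonatomic_measure_def)
  moreover have "1 / 2 \<in> measure_support L"
    unfolding measure_support_def
  proof (intro CollectI conjI allI impI)
    show "1 / 2 \<in> space L" by (simp add: L_def space_restrict_space)
    fix U :: "real set" assume U: "open U" "1 / 2 \<in> U"
    then obtain e where e: "e > 0" "ball (1 / 2) e \<subseteq> U"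
      by (meson open_contains_ball)
    define d where "d = min e (1 / 2)"
    have d: "d > 0" "d \<le> e" "d \<le> 1 / 2" using e by (auto simp: d_def)
    have sub: "{1 / 2 ..< 1 / 2 + d} \<subseteq> U \<inter> space L"
      using d e(2) by (auto simp: L_def space_restrict_space subset_iff dist_real_def)
    have UL: "U \<inter> space L \<in> sets L"
      using U by (auto simp: L_def space_restrict_space sets_restrict_space_iff)
    have "0 < emeasure lborel {1 / 2 ..< 1 / 2 + d}"
      using d by simp
    also have "\<dots> = emeasure L {1 / 2 ..< 1 / 2 + d}"
      using d unfolding L_def by (subst emeasure_restrict_space) auto
    also have "\<dots> \<le> emeasure L (U \<inter> space L)"
      by (rule emeasure_mono[OF sub UL])
    finally show "emeasure L (U \<inter> space L) > 0" .
  qed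
  ultimately show "\<not> measure_support L \<subseteq> measure_support (maximal_nonatomic_measure (\<lambda>x. x))"
    by blast
qed

end

theory Submission
  imports Defs
begin

text \<open>
  Let \<open>\<sigma>\<close> be a linear combination of invariant measures that do not charge the periodic points,
  and put \<open>F x = \<sigma> {0..<x}\<close>, a continuous function. If \<open>F\<close> vanishes at all the points \<open>t k\<close>, then
  invariance of \<open>\<sigma>\<close> says that \<open>F x\<close> is the sum of \<open>F\<close> over the preimages of \<open>x\<close>. The same identity
  follows for the positive part of \<open>F\<close> by comparing integrals, so \<open>F\<close> does not decrease along orbits
  in \<open>{F > 0}\<close>. Since no \<open>t k\<close> lies in this open set, \<open>S\<close> translates each of its components into a
  component; as the lengths do not decrease, some component is visited twice and hence consists of
  periodic points. There \<open>\<sigma>\<close> vanishes, so \<open>F\<close> is constant on the component and \<open>0\<close> at its ends, a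
  contradiction. Thus \<open>\<sigma> = 0\<close>, and at most \<open>n\<close> such measures are linearly independent.

  Consequently there are at most \<open>n\<close> non-atomic ergodic measures, and repeatedly splitting an
  invariant measure without mass on the periodic points along invariant sets stops at ergodic
  pieces, one of which charges any given open set of positive measure. A periodic point is the left
  end of a rigid segment, which handles the remaining mass.
\<close>

section \<open>Interval translation maps and rigid segments\<close>

lemma partition_piece_exists:
  fixes t :: "nat \<Rightarrow> real"
  assumes "t 0 \<le> x" "x < t n"
  shows "\<exists>k\<in>{1..n}. t (k - 1) \<le> x \<and> x < t k"
  using assms
proof (induction n)
  case (Suc n)
  show ?case
  proof (cases "x < t n")
    case True
    then show ?thesis using Suc by fastforce
  next
    case False
    then show ?thesis using Suc.prems by (intro bexI[of _ "Suc n"]) auto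
  qed
qed simp

text \<open>Repeating a nonzero translation leaves every bounded set. This turns a component that
  some iterate translates into itself into a set of fixed points of that iterate.\<close>

lemma translate_subset_bounded_eq_0:
  fixes D :: "real set"
  assumes "bounded D" "x \<in> D" "\<And>y. y \<in> D \<Longrightarrow> y + d \<in> D"
  shows "d = 0"
proof (rule ccontr)
  assume d: "d \<noteq> 0"
  have mem: "x + real k * d \<in> D" for k
  proof (induction k)
    case (Suc k)
    then show ?case using assms(3)[of "x + real k * d"] by (simp add: algebra_simps)
  qed (use assms in simp)
  obtain B where B: "\<And>y. y \<in> D \<Longrightarrow> \<bar>y\<bar> \<le> B"
    using assms(1) by (auto simp: bounded_iff)
  obtain k :: nat where k: "real k > (B + \<bar>x\<bar>) / \<bar>d\<bar>"
    using reals_Archimedean2 by blast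
  then have "real k * \<bar>d\<bar> > B + \<bar>x\<bar>" using d by (simp add: field_simps)
  moreover have "\<bar>real k * d\<bar> \<le> \<bar>x + real k * d\<bar> + \<bar>x\<bar>" by simp
  ultimately show False using B[OF mem[of k]] by (simp add: abs_mult)
qed

section \<open>Pieces of the map, and iterates to the right of a point\<close>

locale interval_translation =
  fixes n :: nat and t c :: "nat \<Rightarrow> real" and S :: "real \<Rightarrow> real"
  assumes itm: "interval_translation_map n t c S"
begin

lemma
  shows t_0: "t 0 = 0" and t_n: "t n = 1"
    and t_less: "k \<in> {1..n} \<Longrightarrow> t (k - 1) < t k"
    and image_ge_0: "k \<in> {1..n} \<Longrightarrow> 0 \<le> t (k - 1) + c k"
    and image_le_1: "k \<in> {1..n} \<Longrightarrow> t k + c k \<le> 1"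
    and S_eq: "k \<in> {1..n} \<Longrightarrow> t (k - 1) \<le> x \<Longrightarrow> x < t k \<Longrightarrow> S x = x + c k"
  using itm by (auto simp: interval_translation_map_def)

lemma t_mono:
  assumes "i \<le> j" "j \<le> n" shows "t i \<le> t j"
  using assms
proof (induction j rule: dec_induct)
  case (step k)
  then show ?case using t_less[of "Suc k"] by simp
qed simp

lemma t_bounds: "k \<le> n \<Longrightarrow> 0 \<le> t k \<and> t k \<le> 1"
  using t_mono[of 0 k] t_mono[of k n] t_0 t_n by simp

lemma piece_exists:
  assumes "x \<in> {0..<1}"
  obtains k where "k \<in> {1..n}" "t (k - 1) \<le> x" "x < t k"
  using partition_piece_exists[of t x n] assms t_0 t_n by auto

lemma piece_unique:
  assumes "k \<in> {1..n}" "t (k - 1) \<le> x" "x < t k"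
    and "l \<in> {1..n}" "t (l - 1) \<le> x" "x < t l"
  shows "k = l"
proof -
  have "\<not> i < j" if "i \<in> {1..n}" "x < t i" "j \<in> {1..n}" "t (j - 1) \<le> x" for i j
    using t_mono[of i "j - 1"] that by force
  then show ?thesis using assms by (meson linorder_neqE_nat)
qed

lemma S_mem: "x \<in> {0..<1} \<Longrightarrow> S x \<in> {0..<1}"
proof -
  assume "x \<in> {0..<1}"
  then obtain k where k: "k \<in> {1..n}" "t (k - 1) \<le> x" "x < t k" using piece_exists by blast
  show ?thesis using image_ge_0[OF k(1)] image_le_1[OF k(1)] S_eq[OF k] k by simp
qed

lemma funpow_S_mem: "x \<in> {0..<1} \<Longrightarrow> (S ^^ m) x \<in> {0..<1}"
  by (induction m) (simp_all add: S_mem del: atLeastLessThan_iff)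

text \<open>The pieces are closed on the left, so each orbit point has some room to its right inside
  its piece. Finitely many iterates share a common \<open>e\<close>, which depends on
  \<open>m\<close>.\<close>

lemma right_translation:
  assumes "x \<in> {0..<1}"
  shows "\<exists>e>0. \<forall>s. 0 \<le> s \<longrightarrow> s < e \<longrightarrow> x + s < 1 \<and> (\<forall>i\<le>m. (S ^^ i) (x + s) = (S ^^ i) x + s)"
proof (induction m)
  case 0
  then show ?case using assms by (intro exI[of _ "1 - x"]) auto
next
  case (Suc m)
  then obtain e where e: "e > 0"
    "\<And>s i. 0 \<le> s \<Longrightarrow> s < e \<Longrightarrow> i \<le> m \<Longrightarrow> x + s < 1 \<and> (S ^^ i) (x + s) = (S ^^ i) x + s"
    by blast
  let ?y = "(S ^^ m) x"
  obtain k where k: "k \<in> {1..n}" "t (k - 1) \<le> ?y" "?y < t k"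
    using piece_exists[OF funpow_S_mem[OF assms]] .
  have "x + s < 1 \<and> (S ^^ i) (x + s) = (S ^^ i) x + s"
    if s: "0 \<le> s" "s < min e (t k - ?y)" "i \<le> Suc m" for s i
  proof (cases "i = Suc m")
    case True
    have "S (?y + s) = S ?y + s" using S_eq[OF k(1)] k s by simp
    then show ?thesis using True e(2)[of s m] s by simp
  next
    case False
    then show ?thesis using e(2)[of s i] s by simp
  qed
  then show ?case using e(1) k by (intro exI[of _ "min e (t k - ?y)"]) auto
qed

text \<open>Right of a point of period \<open>m\<close>, the first \<open>m\<close> iterates are
  translations and \<open>S ^^ m\<close> is the identity. Reducing exponents modulo \<open>m\<close>
  makes every iterate a translation there, with one \<open>e\<close> for all of them.\<close>

lemma periodic_rigid:
  assumes "x \<in> periodic_points S"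
  obtains e where "e > 0" "rigid_segment S {x..<x + e}"
proof -
  obtain m where x: "x \<in> {0..<1}" and m: "m \<ge> 1" "(S ^^ m) x = x"
    using assms by (auto simp: periodic_points_def)
  obtain e where e: "e > 0"
    "\<And>s i. 0 \<le> s \<Longrightarrow> s < e \<Longrightarrow> i \<le> m \<Longrightarrow> x + s < 1 \<and> (S ^^ i) (x + s) = (S ^^ i) x + s"
    using right_translation[OF x, of m] by blast
  have tr: "(S ^^ i) y = y + ((S ^^ i) x - x)" if y: "y \<in> {x..<x + e}" for i y
  proof -
    have s: "0 \<le> y - x" "y - x < e" using y by auto
    have "(S ^^ m) y = y" using e(2)[OF s, of m] m by simp
    then have "(S ^^ i) y = (S ^^ (i mod m)) y" by (simp add: funpow_mod_eq)
    also have "\<dots> = (S ^^ (i mod m)) x + (y - x)"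
      using e(2)[OF s, of "i mod m"] m(1) by (simp add: less_imp_le)
    also have "(S ^^ (i mod m)) x = (S ^^ i) x" using m by (simp add: funpow_mod_eq)
    finally show ?thesis by simp
  qed
  have "continuous_on {x..<x + e} (S ^^ i)" for i
  proof -
    have "continuous_on {x..<x + e} (\<lambda>y. y + ((S ^^ i) x - x))" by (intro continuous_intros)
    then show ?thesis using tr[of _ i] by (metis (no_types, lifting) continuous_on_cong)
  qed
  moreover have "x \<in> {x..<x + e}" "x + e / 2 \<in> {x..<x + e}" "x < x + e / 2" using e(1) by auto
  moreover have "{x..<x + e} \<subseteq> {0..<1}"
  proof
    fix y assume "y \<in> {x..<x + e}"
    then show "y \<in> {0..<1}" using e(2)[of "y - x" 0] x by auto
  qed
  ultimately have "rigid_segment S {x..<x + e}"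
    unfolding rigid_segment_def is_interval_1 by (meson atLeastLessThan_iff order.trans order_le_less_trans)
  then show ?thesis using that e(1) by blast
qed

end

text \<open>There may be uncountably many rigid segments. Grouping them by a rational point they
  contain gives countably many unions, each connected and hence an interval.\<close>

lemma Union_rigid_segments_borel: "\<Union>{J. rigid_segment S J} \<in> sets borel"
proof -
  let ?W = "\<lambda>(q::rat). \<Union>{J. rigid_segment S J \<and> of_rat q \<in> J}"
  have "\<Union>{J. rigid_segment S J} = (\<Union>q. ?W q)"
  proof (intro equalityI subsetI)
    fix x assume "x \<in> \<Union>{J. rigid_segment S J}"
    then obtain J where J: "x \<in> J" "rigid_segment S J" by blast
    then obtain a b where ab: "a \<in> J" "b \<in> J" "a < b" unfolding rigid_segment_def by blast
    obtain q where q: "a < of_rat q" "of_rat q < b" using of_rat_dense[OF ab(3)] by blast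
    then have "of_rat q \<in> J" using J ab by (meson is_interval_1 less_imp_le rigid_segment_def)
    then show "x \<in> (\<Union>q. ?W q)" using J by blast
  qed blast
  moreover have "?W q \<in> sets borel" for q
  proof -
    have "connected (?W q)"
      by (rule connected_Union) (auto simp: rigid_segment_def is_interval_connected_1)
    then show ?thesis
      using is_interval_connected_1 real_interval_borel_measurable by blast
  qed
  ultimately show ?thesis by auto
qed

section \<open>Fixed points of the transfer operator\<close>

context interval_translation
begin

text \<open>Within piece \<open>k\<close>, the points that \<open>S\<close> sends below
  \<open>x\<close> are exactly those left of \<open>clip k (x - c k)\<close>. So for
  \<open>F\<close> vanishing at the partition points, summing \<open>F (clip k (x - c k))\<close>
  over \<open>k\<close> is the transfer operator of \<open>S\<close>, free of case
  distinctions.\<close>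

definition clip :: "nat \<Rightarrow> real \<Rightarrow> real" where
  "clip k y = max (t (k - 1)) (min (t k) y)"

lemma continuous_clip [continuous_intros]:
  "continuous_on X f \<Longrightarrow> continuous_on X (\<lambda>x. clip k (f x))"
  unfolding clip_def by (intro continuous_intros)

lemma clip_bounds: "k \<in> {1..n} \<Longrightarrow> t (k - 1) \<le> clip k y \<and> clip k y \<le> t k"
  using t_less[of k] by (auto simp: clip_def)

lemma clip_mem: "k \<in> {1..n} \<Longrightarrow> clip k y \<in> {0..1}"
  using clip_bounds[of k y] t_bounds[of k] t_mono[of 0 "k - 1"] t_0 by fastforce

lemma integral_pieces:
  fixes g :: "real \<Rightarrow> real"
  assumes "continuous_on {0..1} g" "m \<le> n"
  shows "(\<Sum>k=1..m. integral {t (k - 1)..t k} g) = integral {0..t m} g"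
  using assms(2)
proof (induction m)
  case 0
  then show ?case by (simp add: t_0)
next
  case (Suc m)
  have b: "0 \<le> t m" "t m \<le> t (Suc m)" "t (Suc m) \<le> 1"
    using t_bounds[of m] t_bounds[of "Suc m"] t_mono[of m "Suc m"] Suc.prems by auto
  have "continuous_on {0..t (Suc m)} g"
    by (rule continuous_on_subset[OF assms(1)]) (use b in auto)
  then have "g integrable_on {0..t (Suc m)}" by (rule integrable_continuous_interval)
  then have "integral {0..t m} g + integral {t m..t (Suc m)} g = integral {0..t (Suc m)} g"
    by (rule Henstock_Kurzweil_Integration.integral_combine[OF b(1,2)])
  then show ?case using Suc by simp
qed

text \<open>On the image of piece \<open>k\<close> the integrand is a translate of \<open>g\<close>.
  Outside it, clipping lands on a partition point, where \<open>g\<close> is 0.\<close>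

lemma clip_has_integral:
  fixes g :: "real \<Rightarrow> real"
  assumes cont: "continuous_on {0..1} g" and zero: "\<And>k. k \<le> n \<Longrightarrow> g (t k) = 0"
    and k: "k \<in> {1..n}"
  shows "((\<lambda>x. g (clip k (x - c k))) has_integral integral {t (k - 1)..t k} g) {0..1}"
proof -
  have tk: "t (k - 1) < t k" "0 \<le> t (k - 1) + c k" "t k + c k \<le> 1"
    using t_less[OF k] image_ge_0[OF k] image_le_1[OF k] .
  have z: "g (t (k - 1)) = 0" "g (t k) = 0" using zero k by auto
  have "continuous_on {t (k - 1)..t k} g"
    by (rule continuous_on_subset[OF cont]) (use t_bounds[of k] t_bounds[of "k - 1"] k in auto)
  then have "(g has_integral integral {t (k - 1)..t k} g) {t (k - 1)..t k}"
    by (intro integrable_integral integrable_continuous_interval)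
  then have "((\<lambda>x. g (x - c k)) has_integral integral {t (k - 1)..t k} g)
      {t (k - 1) + c k..t k + c k}"
    using has_integral_affinity'[of g _ "t (k - 1)" "t k" 1 "- c k"] by (simp add: add.commute)
  then have "((\<lambda>x. g (clip k (x - c k))) has_integral integral {t (k - 1)..t k} g)
      {t (k - 1) + c k..t k + c k}"
    by (rule has_integral_eq[rotated]) (auto simp: clip_def)
  then show ?thesis
  proof (rule has_integral_on_superset)
    fix x assume "x \<notin> {t (k - 1) + c k..t k + c k}"
    then have "clip k (x - c k) = t (k - 1) \<or> clip k (x - c k) = t k"
      using tk by (auto simp: clip_def)
    then show "g (clip k (x - c k)) = 0" using z by auto
  qed (use tk in auto)
qed

text \<open>
  Summing over preimages preserves the Lebesgue integral. Taking positive parts can only increase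
  the right-hand side of the functional equation, so the positive part satisfies it as well.
\<close>

lemma transfer_fixed_nonincreasing:
  fixes F :: "real \<Rightarrow> real"
  assumes cont: "continuous_on {0..1} F" and zero: "\<And>k. k \<le> n \<Longrightarrow> F (t k) = 0"
    and fixpt: "\<And>x. x \<in> {0..1} \<Longrightarrow> F x = (\<Sum>k=1..n. F (clip k (x - c k)))"
    and x: "x \<in> {0..<1}"
  shows "max 0 (F x) \<le> max 0 (F (S x))"
proof -
  define g where "g y = max 0 (F y)" for y
  let ?G = "\<lambda>y. \<Sum>k=1..n. g (clip k (y - c k))"
  have gcont: "continuous_on {0..1} g" unfolding g_def by (intro continuous_intros cont)
  have gz: "g (t k) = 0" if "k \<le> n" for k using zero[OF that] by (simp add: g_def)
  have "continuous_on {0..1} (\<lambda>y. g (clip k (y - c k)))" if "k \<in> {1..n}" for k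
    by (rule continuous_on_compose2[OF gcont]) (use clip_mem[OF that] in \<open>auto intro!: continuous_intros\<close>)
  then have Gcont: "continuous_on {0..1} (\<lambda>y. ?G y - g y)"
    by (intro continuous_intros gcont) auto
  have le: "g y \<le> ?G y" if "y \<in> {0..1}" for y
  proof -
    have "F y \<le> ?G y" unfolding fixpt[OF that] by (rule sum_mono) (simp add: g_def)
    moreover have "0 \<le> ?G y" by (rule sum_nonneg) (simp add: g_def)
    ultimately show ?thesis by (simp add: g_def)
  qed
  have "(?G has_integral (\<Sum>k=1..n. integral {t (k - 1)..t k} g)) {0..1}"
    by (intro has_integral_sum clip_has_integral gcont gz) auto
  moreover have "(g has_integral integral {0..1} g) {0..1}"
    by (intro integrable_integral integrable_continuous_interval gcont)
  ultimately have "((\<lambda>y. ?G y - g y) has_integral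
      (\<Sum>k=1..n. integral {t (k - 1)..t k} g) - integral {0..1} g) {0..1}"
    by (rule has_integral_diff)
  moreover have "(\<Sum>k=1..n. integral {t (k - 1)..t k} g) = integral {0..1} g"
    using integral_pieces[OF gcont order_refl] t_n by simp
  ultimately have int0: "((\<lambda>y. ?G y - g y) has_integral 0) {0..1}" by simp
  \<comment> \<open>A continuous nonnegative function with integral 0 vanishes at every point, not
    just almost everywhere.\<close>
  have eq: "?G y - g y = 0" if "y \<in> {0..1}" for y
    by (rule has_integral_0_cbox_imp_0[of 0 1 "\<lambda>y. ?G y - g y" y])
      (use Gcont le that int0 in \<open>simp_all add: box_real less_imp_le\<close>)
  obtain k where k: "k \<in> {1..n}" "t (k - 1) \<le> x" "x < t k" using piece_exists[OF x] .
  \<comment> \<open>\<open>x\<close> is one of the preimages summed over in \<open>?G (S x)\<close>,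
    and the other terms are nonnegative.\<close>
  have "g x = g (clip k (S x - c k))" using S_eq[OF k] k by (simp add: clip_def)
  also have "\<dots> \<le> ?G (S x)"
    using k by (intro member_le_sum[of k "{1..n}" "\<lambda>k. g (clip k (S x - c k))"]) (auto simp: g_def)
  also have "\<dots> = g (S x)" using eq[of "S x"] S_mem[OF x] by simp
  finally show ?thesis by (simp add: g_def)
qed

text \<open>The hypothesis \<open>const\<close> is the form in which the absence of mass on the
  periodic points enters. It contradicts the existence of a component of \<open>{F > 0}\<close> that
  consists of periodic points.\<close>

lemma transfer_fixed_nonpos:
  fixes F :: "real \<Rightarrow> real"
  assumes cont: "continuous_on {0..1} F" and zero: "\<And>k. k \<le> n \<Longrightarrow> F (t k) = 0"
    and fixpt: "\<And>x. x \<in> {0..1} \<Longrightarrow> F x = (\<Sum>k=1..n. F (clip k (x - c k)))"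
    and const: "\<And>x y. 0 \<le> x \<Longrightarrow> x < y \<Longrightarrow> y < 1 \<Longrightarrow> {x<..<y} \<subseteq> periodic_points S \<Longrightarrow> F x = F y"
    and x0: "x0 \<in> {0..1}"
  shows "F x0 \<le> 0"
proof (rule ccontr)
  assume "\<not> F x0 \<le> 0"
  then have x0_pos: "F x0 > 0" by simp
  define U where "U = {x \<in> {0<..<1}. F x > 0}"
  have F01: "F 0 = 0" "F 1 = 0" using zero[of 0] zero[of n] t_0 t_n by auto
  have "continuous_on {0<..<1} F" by (rule continuous_on_subset[OF cont]) auto
  then have "open (F -` {0<..} \<inter> {0<..<1})"
    using continuous_on_open_vimage[of "{0<..<1}" F] open_greaterThan open_greaterThanLessThan by blast
  moreover have "U = F -` {0<..} \<inter> {0<..<1}" by (auto simp: U_def)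
  ultimately have "open U" by simp
  have U_iff: "y \<in> U \<longleftrightarrow> y \<in> {0..<1} \<and> F y > 0" for y
    using F01 by (cases "y = 0") (auto simp: U_def)
  have SU: "S y \<in> U" if "y \<in> U" for y
    using transfer_fixed_nonincreasing[OF cont zero fixpt, of y] that S_mem[of y]
    by (auto simp: U_iff simp del: atLeastLessThan_iff)
  have x0U: "x0 \<in> U" using x0 x0_pos F01 by (cases "x0 = 1") (auto simp: U_iff)
  define C where "C y = connected_component_set U y" for y
  have C_sub: "C y \<subseteq> U" for y unfolding C_def by (rule connected_component_subset)
  have C_conn: "connected (C y)" for y unfolding C_def by (rule connected_connected_component)
  have C_open: "open (C y)" for y
    unfolding C_def by (rule open_connected_component[OF \<open>open U\<close>])
  have C_self: "y \<in> C y" if "y \<in> U" for y using that by (simp add: C_def)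
  have C_mid: "z \<in> C w" if "y \<in> C w" "y' \<in> C w" "y \<le> z" "z \<le> y'" for w y y' z
    using C_conn[of w] that connected_contains_Icc[of "C w" y y'] by auto
  \<comment> \<open>\<open>F\<close> is 0 at the partition points, so a component contains none of
    them and lies in a single piece. Its translate is connected and stays in \<open>U\<close>, hence
    lies in one component.\<close>
  have C_tr: "S z = z + (S y - y) \<and> z + (S y - y) \<in> C (S y)" if y: "y \<in> U" and z: "z \<in> C y" for y z
  proof -
    obtain k where k: "k \<in> {1..n}" "t (k - 1) \<le> y" "y < t k"
      using piece_exists[of y] y by (auto simp: U_iff simp del: atLeastLessThan_iff)
    have no_t: "t i \<notin> C y" if "i \<le> n" for i using zero[OF that] C_sub[of y] by (auto simp: U_def)
    have piece: "t (k - 1) \<le> w \<and> w < t k" if "w \<in> C y" for w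
      using C_mid[OF C_self[OF y] that, of "t k"] C_mid[OF that C_self[OF y], of "t (k - 1)"]
        no_t[of k] no_t[of "k - 1"] k by fastforce
    have SC: "S w = w + c k" if "w \<in> C y" for w using S_eq[OF k(1)] piece[OF that] by simp
    have "connected ((\<lambda>w. w + c k) ` C y)"
      by (rule connected_continuous_image[OF _ C_conn]) (intro continuous_intros)
    moreover have "(\<lambda>w. w + c k) ` C y \<subseteq> U" 
    proof (rule image_subsetI)
      fix w assume "w \<in> C y"
      then show "w + c k \<in> U" using SC[of w] SU[of w] C_sub[of y] by auto
    qed
    moreover have "S y \<in> (\<lambda>w. w + c k) ` C y" using SC[OF C_self[OF y]] C_self[OF y] by simp
    ultimately have "(\<lambda>w. w + c k) ` C y \<subseteq> C (S y)"
      unfolding C_def by (intro connected_component_maximal)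
    then show ?thesis using SC[OF z] SC[OF C_self[OF y]] z by auto
  qed
  define X where "X m = (S ^^ m) x0" for m
  have XU: "X m \<in> U" for m by (induction m) (use x0U SU in \<open>auto simp: X_def\<close>)
  have C_tr_iter: "(S ^^ m) z = z + ((S ^^ m) y - y) \<and> z + ((S ^^ m) y - y) \<in> C ((S ^^ m) y)"
    if y: "y \<in> U" and z: "z \<in> C y" for m y z
  proof (induction m)
    case 0
    then show ?case using z by simp
  next
    case (Suc m)
    have "(S ^^ m) y \<in> U" by (induction m) (use y SU in auto)
    moreover from Suc have "(S ^^ m) z = z + ((S ^^ m) y - y)" "(S ^^ m) z \<in> C ((S ^^ m) y)" by auto
    ultimately show ?case using C_tr[of "(S ^^ m) y" "(S ^^ m) z"] by simp
  qed
  obtain e where e: "e > 0" "ball x0 e \<subseteq> C x0"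
    using C_open[of x0] C_self[OF x0U] open_contains_ball by blast
  \<comment> \<open>The components of later orbit points contain translates of \<open>C x0\<close>,
    so the radius found at \<open>x0\<close> serves along the whole orbit.\<close>
  have ball_C: "ball (X m) e \<subseteq> C (X m)" for m
  proof
    fix w assume "w \<in> ball (X m) e"
    then have "w - X m + x0 \<in> ball x0 e" by (simp add: dist_real_def)
    then have "w - X m + x0 \<in> C x0" using e(2) by blast
    then show "w \<in> C (X m)" using C_tr_iter[OF x0U, of _ m] by (fastforce simp: X_def)
  qed
  \<comment> \<open>Pigeonhole on cells of length \<open>e\<close>: two orbit points in the same
    cell are less than \<open>e\<close> apart, so they share a component by
    \<open>ball_C\<close>.\<close>
  have "\<exists>i j. i < j \<and> C (X i) = C (X j)"
  proof -
    let ?h = "\<lambda>m. \<lfloor>X m / e\<rfloor>"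
    have "?h m \<in> {0..\<lfloor>1 / e\<rfloor>}" for m
      using XU[of m] e(1) by (auto simp: U_def intro!: floor_mono divide_right_mono)
    then have "finite (range ?h)" by (meson finite_atLeastAtMost_int finite_subset image_subsetI)
    then have "\<not> inj ?h" using finite_imageD by blast
    then obtain i j where "i \<noteq> j" "?h i = ?h j" by (auto simp: inj_on_def)
    then obtain i j where ij: "i < j" "?h i = ?h j" by (metis linorder_neqE_nat)
    have "\<bar>X j / e - X i / e\<bar> < 1" using ij(2) by linarith
    then have "X j \<in> ball (X i) e" using e(1)
      by (simp add: dist_real_def diff_divide_distrib[symmetric] abs_divide abs_minus_commute)
    then have "X j \<in> C (X i)" using ball_C by blast
    then have "C (X i) = C (X j)" unfolding C_def by (metis connected_component_eq)
    then show ?thesis using ij(1) by blast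
  qed
  then obtain i j where ij: "i < j" "C (X i) = C (X j)" by blast
  define p where "p = j - i"
  define y where "y = X i"
  have yU: "y \<in> U" using XU by (simp add: y_def)
  have Sp: "(S ^^ p) y = X j"
    using ij(1) funpow_add[of p i S] by (simp add: y_def X_def p_def)
  have bdd: "bounded (C y)"
    by (rule bounded_subset[of "{0..1}"]) (use C_sub[of y] in \<open>auto simp: U_def\<close>)
  \<comment> \<open>\<open>S ^^ p\<close> translates the bounded set \<open>C y\<close> into
    itself.\<close>
  have "(S ^^ p) y - y = 0"
  proof (rule translate_subset_bounded_eq_0[OF bdd C_self[OF yU]])
    fix z assume "z \<in> C y"
    then show "z + ((S ^^ p) y - y) \<in> C y"
      using C_tr_iter[OF yU, of z p] Sp ij(2) by (simp add: y_def)
  qed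
  then have "(S ^^ p) z = z" if "z \<in> C y" for z using C_tr_iter[OF yU that, of p] by simp
  moreover have "p \<ge> 1" using ij(1) by (simp add: p_def)
  ultimately have per: "C y \<subseteq> periodic_points S"
    using C_sub[of y] unfolding periodic_points_def U_def
    by (smt (verit, best) atLeastLessThan_iff greaterThanLessThan_iff mem_Collect_eq subset_iff)
  \<comment> \<open>Since the points between \<open>a\<close> and \<open>y\<close> are periodic,
    \<open>F a = F y > 0\<close>. Then \<open>a\<close> would belong to \<open>U\<close> and to the
    component, but an open set does not contain its infimum.\<close>
  define a where "a = Inf (C y)"
  have below: "bdd_below (C y)" using bdd by (rule bounded_imp_bdd_below)
  have a_le: "a \<le> z" if "z \<in> C y" for z unfolding a_def by (rule cInf_lower[OF that below])
  have a_notin: "a \<notin> C y"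
  proof
    assume "a \<in> C y"
    then obtain e where "e > 0" "ball a e \<subseteq> C y" using C_open open_contains_ball by blast
    then have "a - e / 2 \<in> C y" by (auto simp: subset_iff dist_real_def)
    then show False using a_le \<open>e > 0\<close> by fastforce
  qed
  have ay: "a < y" using a_le[OF C_self[OF yU]] a_notin C_self[OF yU] by (cases "a = y") auto
  have sub: "{a<..y} \<subseteq> C y"
  proof
    fix z assume z: "z \<in> {a<..y}"
    then obtain w where "w \<in> C y" "w < z"
      using cInf_lessD[of "C y" z] C_self[OF yU] by (auto simp: a_def)
    then show "z \<in> C y" using C_mid[of w y y z] C_self[OF yU] z by auto
  qed
  have a0: "0 \<le> a" unfolding a_def
    by (rule cInf_greatest) (use C_self[OF yU] C_sub[of y] in \<open>auto simp: U_def\<close>)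
  have y1: "y < 1" using yU by (simp add: U_def)
  have "{a<..<y} \<subseteq> periodic_points S"
  proof -
    have "{a<..<y} \<subseteq> {a<..y}" by auto
    then show ?thesis using sub per by (meson order_trans)
  qed
  then have "F a = F y" using const[of a y] a0 ay y1 by simp
  then have "a \<in> U" using yU a0 ay y1 by (auto simp: U_iff)
  have "{a..y} = insert a {a<..y}" using ay by auto
  then have "{a..y} \<subseteq> U" using sub C_sub[of y] \<open>a \<in> U\<close> by auto
  then have "{a..y} \<subseteq> C y"
    unfolding C_def using ay by (intro connected_component_maximal) auto
  then have "a \<in> C y" using ay by (meson atLeastAtMost_iff less_imp_le order_refl subsetD)
  then show False using a_notin by blast
qed

end

section \<open>Invariant probability measures\<close>

lemma exists_linear_relation:
  fixes b :: "nat \<Rightarrow> 'j \<Rightarrow> real"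
  assumes "finite J" "card J > m"
  shows "\<exists>a. (\<exists>j\<in>J. a j \<noteq> 0) \<and> (\<forall>k<m. (\<Sum>j\<in>J. a j * b k j) = 0)"
  using assms
proof (induction m arbitrary: J b)
  case 0
  then obtain j where "j \<in> J" by fastforce
  then show ?case by (intro exI[of _ "\<lambda>_. 1"]) auto
next
  case (Suc m)
  show ?case
  proof (cases "\<forall>j\<in>J. b m j = 0")
    case True
    obtain a where "\<exists>j\<in>J. a j \<noteq> 0" "\<forall>k<m. (\<Sum>j\<in>J. a j * b k j) = 0"
      using Suc.IH[of J b] Suc.prems by auto
    then show ?thesis using True by (intro exI[of _ a]) (auto simp: less_Suc_eq)
  next
    case False
    then obtain p where p: "p \<in> J" "b m p \<noteq> 0" by blast
    \<comment> \<open>Gaussian elimination: equation \<open>m\<close> is solved for the unknown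
      \<open>p\<close> and substituted into the others.\<close>
    let ?J = "J - {p}"
    have "finite ?J" "card ?J > m" using Suc.prems p by auto
    from Suc.IH[OF this, of "\<lambda>k j. b k j - b k p * b m j / b m p"]
    obtain a where a: "\<exists>j\<in>?J. a j \<noteq> 0"
      "\<And>k. k < m \<Longrightarrow> (\<Sum>j\<in>?J. a j * (b k j - b k p * b m j / b m p)) = 0" by blast
    define s where "s = (\<Sum>j\<in>?J. a j * b m j) / b m p"
    define a' where "a' = a(p := - s)"
    have sum: "(\<Sum>j\<in>J. a' j * b k j) = (\<Sum>j\<in>?J. a j * b k j) - s * b k p" for k
    proof -
      have "(\<Sum>j\<in>?J. a' j * b k j) = (\<Sum>j\<in>?J. a j * b k j)"
        by (rule sum.cong) (auto simp: a'_def)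
      then show ?thesis using sum.remove[OF Suc.prems(1) p(1), of "\<lambda>j. a' j * b k j"]
        by (simp add: a'_def)
    qed
    have "(\<Sum>j\<in>J. a' j * b k j) = 0" if "k < Suc m" for k
    proof (cases "k = m")
      case True
      then show ?thesis using p by (simp add: sum s_def)
    next
      case False
      then have "0 = (\<Sum>j\<in>?J. a j * (b k j - b k p * b m j / b m p))" using a(2) that by simp
      also have "\<dots> = (\<Sum>j\<in>?J. a j * b k j) - (\<Sum>j\<in>?J. (a j * b m j) * (b k p / b m p))"
        by (simp add: right_diff_distrib sum_subtractf ac_simps)
      also have "\<dots> = (\<Sum>j\<in>?J. a j * b k j) - s * b k p"
        unfolding sum_distrib_right[symmetric] s_def by simp
      finally show ?thesis by (simp add: sum)
    qed
    moreover have "\<exists>j\<in>J. a' j \<noteq> 0" using a(1) by (auto simp: a'_def)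
    ultimately show ?thesis by blast
  qed
qed

text \<open>Null level sets make the distribution function of \<open>f\<close> continuous, so it
  takes the middle value. This is applied to the identity on a supposed atom and to the orbit
  minimum on periodic points.\<close>

lemma (in finite_measure) halving_level:
  fixes f :: "'a \<Rightarrow> real"
  assumes f [measurable]: "f \<in> borel_measurable M"
    and null: "\<And>r. measure M {x \<in> space M. f x = r} = 0"
  shows "\<exists>r. measure M {x \<in> space M. f x \<le> r} = measure M (space M) / 2"
proof (cases "measure M (space M) = 0")
  case True
  then show ?thesis using bounded_measure[of "{x \<in> space M. f x \<le> 0}"]
    by (intro exI[of _ 0]) (simp add: antisym)
next
  case False
  define D where "D = distr M borel f"
  interpret D: finite_borel_measure D
    by (intro finite_borel_measure.intro finite_measure_distr finite_borel_measure_axioms.intro)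
      (auto simp: D_def finite_measure_distr)
  have tot: "measure D (space D) = measure M (space M)"
    by (simp add: D_def measure_distr)
  have "isCont (cdf D) x" for x
    unfolding D.isCont_cdf using null[of x] by (simp add: D_def measure_distr vimage_def Int_def conj_commute)
  then have cont: "continuous_on X (cdf D)" for X by (simp add: continuous_at_imp_continuous_on)
  let ?h = "measure M (space M) / 2"
  have pos: "0 < ?h" "?h < measure M (space M)" using False by (auto simp: zero_less_measure_iff)
  have "eventually (\<lambda>x. cdf D x < ?h) at_bot" by (rule order_tendstoD(2)[OF D.cdf_lim_at_bot pos(1)])
  then obtain a where a: "cdf D a < ?h" by (auto simp: eventually_at_bot_linorder)
  have "eventually (\<lambda>x. ?h < cdf D x) at_top"
    using order_tendstoD(1)[OF D.cdf_lim_at_top, of ?h] pos(2) tot by simp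
  then obtain b where b: "?h < cdf D b" by (auto simp: eventually_at_top_linorder)
  have "a \<le> b" using a b D.cdf_nondecreasing[of b a] by linarith
  then obtain r where "cdf D r = ?h" using IVT'[of "cdf D" a ?h b] a b cont by auto
  moreover have "cdf D r = measure M {x \<in> space M. f x \<le> r}"
    by (simp add: cdf_def D_def measure_distr vimage_def Int_def conj_commute)
  ultimately show ?thesis by auto
qed

text \<open>If points are null, a threshold \<open>r\<close> cuts any set of positive measure into
  two halves, so there are no atoms.\<close>

lemma nonatomicI:
  assumes "finite_measure \<mu>" "sets \<mu> = sets unit_borel" and null: "\<And>x. measure \<mu> {x} = 0"
  shows "nonatomic_measure \<mu>"
  unfolding nonatomic_measure_def
proof
  interpret finite_measure \<mu> by fact
  have id [measurable]: "(\<lambda>x. x) \<in> borel_measurable \<mu>"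
    unfolding measurable_cong_sets[OF assms(2) refl] by (rule measurable_restrict_space1) simp
  assume "\<exists>A. atom_of \<mu> A"
  then obtain A where A [measurable]: "A \<in> sets \<mu>" and Apos: "emeasure \<mu> A > 0"
    and at: "\<And>B. B \<in> sets \<mu> \<Longrightarrow> B \<subseteq> A \<Longrightarrow> emeasure \<mu> B = 0 \<or> emeasure \<mu> (A - B) = 0"
    by (auto simp: atom_of_def)
  have Asub: "A \<subseteq> space \<mu>" using sets.sets_into_space[OF A] .
  let ?R = "restrict_space \<mu> A"
  interpret R: finite_measure ?R by (rule finite_measure_restrict_space) (use finite_measure_axioms A Asub in auto)
  have R: "measure ?R B = measure \<mu> B" if "B \<subseteq> A" for B
    using that A Asub by (intro measure_restrict_space) auto
  have spR: "space ?R = A" using Asub by (auto simp: space_restrict_space)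
  have "\<exists>r. measure ?R {x \<in> space ?R. x \<le> r} = measure ?R (space ?R) / 2"
  proof (rule R.halving_level)
    show "(\<lambda>x. x) \<in> borel_measurable ?R" by (rule measurable_restrict_space1) (rule id)
    fix r
    have "{x \<in> space ?R. x = r} = (if r \<in> A then {r} else {})" using spR by auto
    then show "measure ?R {x \<in> space ?R. x = r} = 0" using null[of r] R[of "{r}"] by simp
  qed
  then obtain r where r: "measure \<mu> {x \<in> A. x \<le> r} = measure \<mu> A / 2"
    using R[of A] R[of "{x \<in> A. x \<le> r}" for r] spR by auto
  define B where "B = {x \<in> A. x \<le> r}"
  have "B = {x \<in> space \<mu>. x \<le> r} \<inter> A" using Asub by (auto simp: B_def)
  then have B [measurable]: "B \<in> sets \<mu>" by simp
  have BA: "B \<subseteq> A" by (auto simp: B_def)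
  have "measure \<mu> A > 0" using Apos by (simp add: emeasure_eq_measure)
  moreover have "measure \<mu> (A - B) = measure \<mu> A - measure \<mu> B"
    using BA by (intro finite_measure_Diff) auto
  ultimately show False using at[OF B BA] r by (simp add: emeasure_eq_measure B_def)
qed

lemma nonatomic_point_null:
  assumes "nonatomic_measure \<mu>"
  shows "measure \<mu> {x} = 0"
proof (rule ccontr)
  assume "measure \<mu> {x} \<noteq> 0"
  then have pos: "emeasure \<mu> {x} > 0" by (metis enn2real_0 gr_zeroI measure_def)
  then have "{x} \<in> sets \<mu>" using emeasure_notin_sets by fastforce
  moreover have "emeasure \<mu> B = 0 \<or> emeasure \<mu> ({x} - B) = 0" if "B \<subseteq> {x}" for B
    using that by (metis Diff_cancel emeasure_empty subset_singletonD)
  ultimately have "atom_of \<mu> {x}" using pos by (auto simp: atom_of_def)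
  then show False using assms by (auto simp: nonatomic_measure_def)
qed

section \<open>Recurrence, saturation and conditioning for one invariant measure\<close>

locale invariant_prob =
  fixes S :: "real \<Rightarrow> real" and \<mu> :: "real measure"
  assumes inv: "invariant_measure S \<mu>"

sublocale invariant_prob \<subseteq> prob_space \<mu>
  using inv by (simp add: invariant_measure_def)

context invariant_prob
begin

lemma sets_eq: "sets \<mu> = sets unit_borel"
  using inv by (simp add: invariant_measure_def)

lemma space_eq [simp]: "space \<mu> = {0..<1}"
  by (rule space_eq_if_sets_unit_borel[OF sets_eq])

lemma measurable_id [measurable]: "(\<lambda>x. x) \<in> borel_measurable \<mu>"
  unfolding measurable_cong_sets[OF sets_eq refl] by (rule measurable_restrict_space1) simp

lemma S_measurable [measurable]: "S \<in> measurable \<mu> \<mu>"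
  using inv by (simp add: invariant_measure_def)

lemma funpow_measurable [measurable]: "(S ^^ m) \<in> measurable \<mu> \<mu>"
proof (induction m)
  case (Suc m)
  then show ?case using measurable_comp[OF Suc S_measurable] by simp
qed (simp add: id_def)

lemma funpow_real_measurable [measurable]: "(S ^^ m) \<in> borel_measurable \<mu>"
  using measurable_comp[OF funpow_measurable measurable_id] by (simp add: comp_def)

lemma S_space: "x \<in> {0..<1} \<Longrightarrow> S x \<in> {0..<1}"
  using measurable_space[OF S_measurable] by simp

lemma Int_sets: "B \<in> sets borel \<Longrightarrow> B \<inter> {0..<1} \<in> sets \<mu>"
  by (auto simp: sets_eq sets_restrict_space_iff)

lemma borel_sets: "B \<in> sets borel \<Longrightarrow> B \<subseteq> {0..<1} \<Longrightarrow> B \<in> sets \<mu>"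
  using Int_sets[of B] by (simp add: Int_absorb2)

lemma preimage_sets: "B \<in> sets \<mu> \<Longrightarrow> S -` B \<inter> {0..<1} \<in> sets \<mu>"
  using measurable_sets[OF S_measurable] by simp

lemma measure_preimage: "B \<in> sets \<mu> \<Longrightarrow> measure \<mu> (S -` B \<inter> {0..<1}) = measure \<mu> B"
  using inv measure_distr[OF S_measurable, of B] by (simp add: invariant_measure_def)

lemma preimage_funpow_Suc:
  "(S ^^ Suc m) -` B \<inter> {0..<1} = S -` ((S ^^ m) -` B \<inter> {0..<1}) \<inter> {0..<1}"
  using S_space by (auto simp: funpow_swap1 simp del: atLeastLessThan_iff)

lemma preimage_funpow_sets: "B \<in> sets \<mu> \<Longrightarrow> (S ^^ m) -` B \<inter> {0..<1} \<in> sets \<mu>"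
  using measurable_sets[OF funpow_measurable] by simp

lemma measure_preimage_funpow:
  assumes "B \<in> sets \<mu>"
  shows "measure \<mu> ((S ^^ m) -` B \<inter> {0..<1}) = measure \<mu> B"
proof (induction m)
  case 0
  then show ?case using sets.sets_into_space[OF assms] by (simp add: Int_absorb2)
next
  case (Suc m)
  then show ?case using measure_preimage[OF preimage_funpow_sets[OF assms]]
    by (simp only: preimage_funpow_Suc)
qed

lemma fixed_points_sets [measurable]: "{x \<in> {0..<1}. (S ^^ m) x = x} \<in> sets \<mu>"
  using borel_measurable_eq[OF funpow_real_measurable measurable_id, of m] by simp

lemma periodic_points_eq: "periodic_points S = (\<Union>m\<in>{1..}. {x \<in> {0..<1}. (S ^^ m) x = x})"
  by (auto simp: periodic_points_def)

lemma periodic_points_sets [measurable]: "periodic_points S \<in> sets \<mu>"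
  unfolding periodic_points_eq by (intro sets.countable_UN' image_subsetI fixed_points_sets countableI_type)

text \<open>The preimages of a non-periodic point under different iterates are disjoint and have
  equal mass, so a finite measure gives them mass 0.\<close>

lemma recurrent_point:
  assumes "measure \<mu> {x} > 0"
  shows "x \<in> periodic_points S"
proof (rule ccontr)
  assume x: "x \<notin> periodic_points S"
  have xs: "{x} \<in> sets \<mu>" using assms measure_notin_sets by fastforce
  then have x01: "x \<in> {0..<1}" using sets.sets_into_space[OF xs] by simp
  let ?B = "\<lambda>i. (S ^^ i) -` {x} \<inter> {0..<1}"
  have disj: "?B i \<inter> ?B j = {}" if "i < j" for i j
  proof (rule ccontr)
    assume "?B i \<inter> ?B j \<noteq> {}"
    then obtain y where "(S ^^ i) y = x" "(S ^^ j) y = x" by auto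
    then have "(S ^^ (j - i)) x = x" using funpow_add[of "j - i" i S] that by simp
    then show False using x x01 that by (auto simp: periodic_points_def dest: spec[of _ "j - i"])
  qed
  have "disjoint_family ?B"
    unfolding disjoint_family_on_def using disj by (metis Int_commute linorder_neqE_nat)
  then have "(\<lambda>i. measure \<mu> (?B i)) sums measure \<mu> (\<Union>i. ?B i)"
    using preimage_funpow_sets[OF xs] by (intro finite_measure_UNION) auto
  then have "(\<lambda>i::nat. measure \<mu> {x}) sums measure \<mu> (\<Union>i. ?B i)"
    by (simp add: measure_preimage_funpow[OF xs])
  then have "summable (\<lambda>i::nat. measure \<mu> {x})" by (rule sums_summable)
  then show False using assms by (simp add: summable_const_iff)
qed

lemma point_null:
  assumes "measure \<mu> (periodic_points S) = 0"
  shows "measure \<mu> {x} = 0"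
proof (rule ccontr)
  assume "measure \<mu> {x} \<noteq> 0"
  then have pos: "measure \<mu> {x} > 0" by (simp add: zero_less_measure_iff)
  then have "{x} \<subseteq> periodic_points S" using recurrent_point by simp
  then have "measure \<mu> {x} \<le> measure \<mu> (periodic_points S)"
    by (intro finite_measure_mono) auto
  then show False using assms pos by simp
qed

lemma nonatomic:
  assumes "measure \<mu> (periodic_points S) = 0"
  shows "nonatomic_measure \<mu>"
  by (rule nonatomicI[OF finite_measure_axioms sets_eq point_null[OF assms]])

text \<open>Forward invariance makes the preimages of \<open>B\<close> increase while their mass
  stays constant. So the union is invariant in the strict sense and exceeds \<open>B\<close> by a
  null set only.\<close>

lemma saturation:
  assumes B: "B \<in> sets \<mu>" and fwd: "B \<subseteq> S -` B"
  defines "E \<equiv> (\<Union>i. (S ^^ i) -` B \<inter> {0..<1})"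
  shows "E \<in> sets \<mu>" "B \<subseteq> E" "S -` E \<inter> {0..<1} = E" "measure \<mu> E = measure \<mu> B"
proof -
  let ?B = "\<lambda>i. (S ^^ i) -` B \<inter> {0..<1}"
  have B01: "B \<subseteq> {0..<1}" using sets.sets_into_space[OF B] by simp
  have Bs: "range ?B \<subseteq> sets \<mu>" using preimage_funpow_sets[OF B] by auto
  then show "E \<in> sets \<mu>" unfolding E_def by (intro sets.countable_UN) auto
  have "?B 0 = B" using B01 by auto
  then show "B \<subseteq> E" unfolding E_def by blast
  have inc: "incseq ?B" using fwd by (intro incseq_SucI) auto
  have "S -` E \<inter> {0..<1} = (\<Union>i. ?B (Suc i))"
    unfolding E_def preimage_funpow_Suc by auto
  also have "\<dots> = E"
    unfolding E_def
  proof (intro equalityI UN_least)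
    fix i show "?B i \<subseteq> (\<Union>i. ?B (Suc i))" using incseq_SucD[OF inc, of i] by blast
  qed blast
  finally show "S -` E \<inter> {0..<1} = E" .
  have "(\<lambda>i. measure \<mu> (?B i)) \<longlonglongrightarrow> measure \<mu> E"
    unfolding E_def by (rule finite_Lim_measure_incseq[OF Bs inc])
  then show "measure \<mu> E = measure \<mu> B"
    by (simp add: measure_preimage_funpow[OF B] LIMSEQ_const_iff)
qed

lemma uniform_measure_invariant:
  assumes A: "A \<in> sets \<mu>" "S -` A \<inter> {0..<1} = A" and pos: "measure \<mu> A > 0"
  shows "invariant_measure S (uniform_measure \<mu> A)"
    and "B \<in> sets \<mu> \<Longrightarrow> measure (uniform_measure \<mu> A) B = measure \<mu> (A \<inter> B) / measure \<mu> A"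
proof -
  let ?U = "uniform_measure \<mu> A"
  have Apos: "emeasure \<mu> A \<noteq> 0" "emeasure \<mu> A \<noteq> \<infinity>" using pos by (auto simp: emeasure_eq_measure)
  have U: "prob_space ?U" by (rule prob_space_uniform_measure[OF Apos])
  have SU: "S \<in> measurable ?U ?U" using S_measurable by (simp add: measurable_def)
  have meas: "measure ?U B = measure \<mu> (A \<inter> B) / measure \<mu> A" if "B \<in> sets \<mu>" for B
    using Apos that by (intro measure_uniform_measure) auto
  then show "B \<in> sets \<mu> \<Longrightarrow> measure ?U B = measure \<mu> (A \<inter> B) / measure \<mu> A" .
  interpret U: prob_space ?U by (rule U)
  have "distr ?U ?U S = ?U"
  proof (rule measure_eqI)
    fix B assume "B \<in> sets (distr ?U ?U S)"
    then have B: "B \<in> sets \<mu>" by simp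
    have eq: "A \<inter> (S -` B \<inter> {0..<1}) = S -` (A \<inter> B) \<inter> {0..<1}" using A(2) by auto
    have "measure ?U (S -` B \<inter> {0..<1}) = measure ?U B"
      using meas[OF preimage_sets[OF B]] meas[OF B] measure_preimage[of "A \<inter> B"] A(1) B
      by (simp add: eq)
    then show "emeasure (distr ?U ?U S) B = emeasure ?U B"
      using B SU by (simp add: emeasure_distr U.emeasure_eq_measure)
  qed simp
  then show "invariant_measure S ?U" using U SU sets_eq by (simp add: invariant_measure_def)
qed

text \<open>The function agrees on \<open>{0..1}\<close> with the distribution function of the
  measure on the line; open and closed rays differ by a null point.\<close>

lemma mass_continuous:
  assumes null: "\<And>x. measure \<mu> {x} = 0"
  shows "continuous_on {0..1} (\<lambda>x. measure \<mu> {0..<x})"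
proof -
  define D where "D = distr \<mu> borel (\<lambda>x. x)"
  interpret D: finite_borel_measure D
    by (intro finite_borel_measure.intro finite_measure_distr finite_borel_measure_axioms.intro)
      (auto simp: D_def finite_measure_distr)
  have null': "measure \<mu> ({x} \<inter> {0..<1}) = 0" for x
    using null[of x] by (cases "x \<in> {0..<1}") auto
  have "isCont (cdf D) x" for x
    unfolding D.isCont_cdf using null'[of x] by (simp add: D_def measure_distr)
  then have "continuous_on {0..1} (cdf D)" by (simp add: continuous_at_imp_continuous_on)
  moreover have "cdf D x = measure \<mu> {0..<x}" if "x \<in> {0..1}" for x
  proof -
    have "cdf D x = measure \<mu> ({..x} \<inter> {0..<1})" by (simp add: cdf_def D_def measure_distr)
    also have "{..x} \<inter> {0..<1} = {0..<x} \<union> ({x} \<inter> {0..<1})" using that by auto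
    also have "measure \<mu> \<dots> = measure \<mu> {0..<x} + measure \<mu> ({x} \<inter> {0..<1})"
      using that by (intro finite_measure_Union borel_sets Int_sets) auto
    finally show ?thesis using null' by simp
  qed
  ultimately show ?thesis by (rule continuous_on_eq)
qed

end

section \<open>Linear independence\<close>

context interval_translation
begin

text \<open>This is invariance of the mass of \<open>{0..<x}\<close>, with the preimage cut along
  the pieces. The subtracted terms at left ends disappear for combinations that vanish at the
  partition points.\<close>

lemma mass_transfer:
  assumes "invariant_measure S \<mu>" and x: "x \<in> {0..1}"
  shows "measure \<mu> {0..<x} =
    (\<Sum>k=1..n. measure \<mu> {0..<clip k (x - c k)} - measure \<mu> {0..<t (k - 1)})"
proof -
  interpret invariant_prob S \<mu> by unfold_locales fact
  let ?I = "\<lambda>k. {t (k - 1)..<clip k (x - c k)}"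
  have bds: "0 \<le> t (k - 1)" "t (k - 1) \<le> clip k (x - c k)" "clip k (x - c k) \<le> t k" "t k \<le> 1"
    if "k \<in> {1..n}" for k
    using clip_bounds[OF that] t_mono[of 0 "k - 1"] t_0 t_bounds[of k] that by auto
  have Is: "?I k \<in> sets \<mu>" if "k \<in> {1..n}" for k
    using bds[OF that] by (intro borel_sets) auto
  have disj: "disjoint_family_on ?I {1..n}"
    unfolding disjoint_family_on_def
  proof (intro ballI impI)
    fix k l assume kl: "k \<in> {1..n}" "l \<in> {1..n}" "k \<noteq> l"
    show "?I k \<inter> ?I l = {}"
    proof (rule ccontr)
      assume "?I k \<inter> ?I l \<noteq> {}"
      then obtain y where "y \<in> ?I k" "y \<in> ?I l" by blast
      then have "t (k - 1) \<le> y" "y < t k" "t (l - 1) \<le> y" "y < t l"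
        using bds[OF kl(1)] bds[OF kl(2)] by auto
      then show False using piece_unique[of k y l] kl by blast
    qed
  qed
  have "S -` {0..<x} \<inter> {0..<1} = (\<Union>k\<in>{1..n}. ?I k)"
  proof (intro equalityI subsetI)
    fix y assume y: "y \<in> S -` {0..<x} \<inter> {0..<1}"
    then obtain k where k: "k \<in> {1..n}" "t (k - 1) \<le> y" "y < t k" using piece_exists by blast
    then have "y \<in> ?I k" using y S_eq[OF k] by (auto simp: clip_def)
    then show "y \<in> (\<Union>k\<in>{1..n}. ?I k)" using k(1) by blast
  next
    fix y assume "y \<in> (\<Union>k\<in>{1..n}. ?I k)"
    then obtain k where k: "k \<in> {1..n}" and y: "t (k - 1) \<le> y" "y < clip k (x - c k)" by auto
    then have y': "y < t k" "y < x - c k" using bds[OF k] by (auto simp: clip_def split: if_splits)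
    have "y \<in> {0..<1}" using y(1) y'(1) bds[OF k] by auto
    then show "y \<in> S -` {0..<x} \<inter> {0..<1}" using S_mem[of y] S_eq[OF k y(1) y'(1)] y' by auto
  qed
  then have "measure \<mu> {0..<x} = measure \<mu> (\<Union>k\<in>{1..n}. ?I k)"
    using measure_preimage[of "{0..<x}"] borel_sets[of "{0..<x}"] x by auto
  also have "\<dots> = (\<Sum>k=1..n. measure \<mu> (?I k))"
    using Is by (intro finite_measure_finite_Union disj) auto
  also have "\<dots> = (\<Sum>k=1..n. measure \<mu> {0..<clip k (x - c k)} - measure \<mu> {0..<t (k - 1)})"
  proof (rule sum.cong[OF refl])
    fix k assume k: "k \<in> {1..n}"
    have "?I k = {0..<clip k (x - c k)} - {0..<t (k - 1)}" using bds[OF k] by auto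
    also have "measure \<mu> \<dots> = measure \<mu> {0..<clip k (x - c k)} - measure \<mu> {0..<t (k - 1)}"
      using bds[OF k] by (intro finite_measure_Diff borel_sets) auto
    finally show "measure \<mu> (?I k) =
      measure \<mu> {0..<clip k (x - c k)} - measure \<mu> {0..<t (k - 1)}" .
  qed
  finally show ?thesis .
qed

lemma linear_combination_nonpos:
  assumes inv: "\<And>j. j \<in> J \<Longrightarrow> invariant_measure S (\<nu> j)"
    and null: "\<And>j. j \<in> J \<Longrightarrow> measure (\<nu> j) (periodic_points S) = 0"
    and zero: "\<And>k. k \<in> {1..n} \<Longrightarrow> (\<Sum>j\<in>J. a j * measure (\<nu> j) {0..<t k}) = 0"
    and x: "x \<in> {0..1}"
  shows "(\<Sum>j\<in>J. a j * measure (\<nu> j) {0..<x}) \<le> 0"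
proof (rule transfer_fixed_nonpos[where F = "\<lambda>x. \<Sum>j\<in>J. a j * measure (\<nu> j) {0..<x}"])
  let ?F = "\<lambda>x. \<Sum>j\<in>J. a j * measure (\<nu> j) {0..<x}"
  have ip: "invariant_prob S (\<nu> j)" if "j \<in> J" for j
    using inv[OF that] by (simp add: invariant_prob_def)
  have pt: "measure (\<nu> j) {y} = 0" if "j \<in> J" for j y
    using invariant_prob.point_null[OF ip[OF that] null[OF that]] .
  show "continuous_on {0..1} ?F"
    by (intro continuous_intros invariant_prob.mass_continuous[OF ip] pt)
  show zero': "?F (t k) = 0" if "k \<le> n" for k
    using zero[of k] that by (cases "k = 0") (auto simp: t_0)
  show "?F y = (\<Sum>k=1..n. ?F (clip k (y - c k)))" if y: "y \<in> {0..1}" for y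
  proof -
    have "?F y = (\<Sum>j\<in>J. \<Sum>k=1..n. a j * measure (\<nu> j) {0..<clip k (y - c k)}
        - a j * measure (\<nu> j) {0..<t (k - 1)})"
      using mass_transfer[OF inv y]
      by (intro sum.cong refl) (simp add: sum_distrib_left right_diff_distrib)
    also have "\<dots> = (\<Sum>k=1..n. \<Sum>j\<in>J. a j * measure (\<nu> j) {0..<clip k (y - c k)}
        - a j * measure (\<nu> j) {0..<t (k - 1)})"
      by (rule sum.swap)
    also have "\<dots> = (\<Sum>k=1..n. ?F (clip k (y - c k)) - ?F (t (k - 1)))"
      by (simp add: sum_subtractf)
    also have "\<dots> = (\<Sum>k=1..n. ?F (clip k (y - c k)))"
    proof (rule sum.cong[OF refl])
      fix k assume "k \<in> {1..n}"
      then have "?F (t (k - 1)) = 0" by (intro zero') auto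
      then show "?F (clip k (y - c k)) - ?F (t (k - 1)) = ?F (clip k (y - c k))" by simp
    qed
    finally show ?thesis .
  qed
  show "?F y = ?F z" if yz: "0 \<le> y" "y < z" "z < 1" "{y<..<z} \<subseteq> periodic_points S" for y z
  proof (rule sum.cong[OF refl])
    fix j assume j: "j \<in> J"
    interpret invariant_prob S "\<nu> j" by (rule ip[OF j])
    have "measure (\<nu> j) {y<..<z} \<le> measure (\<nu> j) (periodic_points S)"
      by (rule finite_measure_mono[OF yz(4)]) simp
    then have z: "measure (\<nu> j) {y<..<z} = 0" using null[OF j] by (simp add: antisym)
    have "{0..<z} = {0..<y} \<union> ({y} \<union> {y<..<z})" using yz by auto
    also have "measure (\<nu> j) \<dots> = measure (\<nu> j) {0..<y} + measure (\<nu> j) ({y} \<union> {y<..<z})"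
      using yz by (intro finite_measure_Union borel_sets) auto
    also have "measure (\<nu> j) ({y} \<union> {y<..<z}) = measure (\<nu> j) {y} + measure (\<nu> j) {y<..<z}"
      using yz by (intro finite_measure_Union borel_sets) auto
    finally show "a j * measure (\<nu> j) {0..<y} = a j * measure (\<nu> j) {0..<z}"
      using z pt[OF j] by simp
  qed
  show "x \<in> {0..1}" by fact
qed

text \<open>Applying \<open>linear_combination_nonpos\<close> to the coefficients and to their
  negatives gives 0 on all \<open>{0..<x}\<close>. Rays form an intersection-stable generator, so
  Dynkin's argument extends this to Borel sets.\<close>

lemma linear_combination_eq_0:
  assumes inv: "\<And>j. j \<in> J \<Longrightarrow> invariant_measure S (\<nu> j)"
    and null: "\<And>j. j \<in> J \<Longrightarrow> measure (\<nu> j) (periodic_points S) = 0"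
    and zero: "\<And>k. k \<in> {1..n} \<Longrightarrow> (\<Sum>j\<in>J. a j * measure (\<nu> j) {0..<t k}) = 0"
    and B: "B \<in> sets borel"
  shows "(\<Sum>j\<in>J. a j * measure (\<nu> j) (B \<inter> {0..<1})) = 0"
proof -
  let ?s = "\<lambda>B. \<Sum>j\<in>J. a j * measure (\<nu> j) (B \<inter> {0..<1})"
  have ip: "invariant_prob S (\<nu> j)" if "j \<in> J" for j
    using inv[OF that] by (simp add: invariant_prob_def)
  have Ico: "(\<Sum>j\<in>J. a j * measure (\<nu> j) {0..<x}) = 0" if "x \<in> {0..1}" for x
  proof -
    have "(\<Sum>j\<in>J. - a j * measure (\<nu> j) {0..<x}) \<le> 0"
      using zero by (intro linear_combination_nonpos inv null that) (simp_all add: sum_negf)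
    then show ?thesis
      using linear_combination_nonpos[OF inv null zero that] by (simp add: sum_negf)
  qed
  have base: "?s {..<x} = 0" for x
  proof -
    have "{..<x} \<inter> {0..<1} = {0..<max 0 (min 1 x)}" by auto
    then show ?thesis using Ico[of "max 0 (min 1 x)"] by auto
  qed
  have stable: "Int_stable (range (lessThan :: real \<Rightarrow> _))" "range (lessThan :: real \<Rightarrow> _) \<subseteq> Pow UNIV"
  proof -
    have "{..<x} \<inter> {..<y} = {..<min x y}" for x y :: real by auto
    then show "Int_stable (range (lessThan :: real \<Rightarrow> _))" by (simp add: Int_stable_def)
  qed simp
  have "B \<in> sigma_sets UNIV (range lessThan)"
    using B unfolding borel_Iio by simp
  with stable show ?thesis
  proof (induction rule: sigma_sets_induct_disjoint)
    case (compl B)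
    then have Bb: "B \<in> sets borel" unfolding borel_Iio by simp
    have "measure (\<nu> j) ((UNIV - B) \<inter> {0..<1}) = measure (\<nu> j) {0..<1} - measure (\<nu> j) (B \<inter> {0..<1})"
      if j: "j \<in> J" for j
    proof -
      interpret invariant_prob S "\<nu> j" by (rule ip[OF j])
      have "(UNIV - B) \<inter> {0..<1} = {0..<1} - B \<inter> {0..<1}" by auto
      then show ?thesis using Bb by (simp add: finite_measure_Diff borel_sets Int_sets)
    qed
    then have "?s (UNIV - B) = (\<Sum>j\<in>J. a j * measure (\<nu> j) {0..<1}) - ?s B"
      by (simp add: right_diff_distrib sum_subtractf)
    then show ?case using compl Ico[of 1] by simp
  next
    case (union A)
    then have Ab: "A i \<in> sets borel" for i unfolding borel_Iio by auto
    have "(\<lambda>i. measure (\<nu> j) (A i \<inter> {0..<1})) sums measure (\<nu> j) ((\<Union>i. A i) \<inter> {0..<1})"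
      if j: "j \<in> J" for j
    proof -
      interpret invariant_prob S "\<nu> j" by (rule ip[OF j])
      have "(\<lambda>i. measure (\<nu> j) (A i \<inter> {0..<1})) sums measure (\<nu> j) (\<Union>i. A i \<inter> {0..<1})"
        using Ab union(1) by (intro finite_measure_UNION)
          (auto intro!: Int_sets simp: disjoint_family_on_def)
      then show ?thesis by simp
    qed
    then have "(\<lambda>i. ?s (A i)) sums ?s (\<Union>i. A i)"
      by (intro sums_sum sums_mult)
    then show ?case using union(3) sums_unique2[OF _ sums_zero] by simp
  qed (use base in auto)
qed

text \<open>More than \<open>n\<close> measures would have a nontrivial combination vanishing on the
  \<open>n\<close> intervals \<open>{0..<t k}\<close>, hence everywhere; evaluated at
  \<open>A i\<close> it yields the coefficient of \<open>i\<close>. The bound serves both for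
  ergodic measures and for the parts of one measure.\<close>

lemma card_separated_measures_le:
  assumes "finite J"
    and inv: "\<And>j. j \<in> J \<Longrightarrow> invariant_measure S (\<nu> j)"
    and null: "\<And>j. j \<in> J \<Longrightarrow> measure (\<nu> j) (periodic_points S) = 0"
    and A: "\<And>j. j \<in> J \<Longrightarrow> A j \<in> sets unit_borel"
    and sep: "\<And>i j. i \<in> J \<Longrightarrow> j \<in> J \<Longrightarrow> measure (\<nu> i) (A j) = (if i = j then 1 else 0)"
  shows "card J \<le> n"
proof (rule ccontr)
  assume "\<not> card J \<le> n"
  \<comment> \<open>Equations are numbered from 0, so number \<open>k\<close> concerns
    \<open>t (Suc k)\<close>; at \<open>t 0\<close> the interval is empty.\<close>
  then obtain a where a: "\<exists>j\<in>J. a j \<noteq> 0"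
    "\<And>k. k < n \<Longrightarrow> (\<Sum>j\<in>J. a j * measure (\<nu> j) {0..<t (Suc k)}) = 0"
    using exists_linear_relation[OF assms(1), of n "\<lambda>k j. measure (\<nu> j) {0..<t (Suc k)}"] by auto
  have zero: "(\<Sum>j\<in>J. a j * measure (\<nu> j) {0..<t k}) = 0" if "k \<in> {1..n}" for k
  proof -
    have "k - 1 < n" using that by auto
    then show ?thesis using a(2)[of "k - 1"] that by simp
  qed
  have "a i = 0" if i: "i \<in> J" for i
  proof -
    have "A i \<in> sets borel" "A i \<inter> {0..<1} = A i" using A[OF i] by (auto simp: sets_restrict_space_iff)
    then have "0 = (\<Sum>j\<in>J. a j * measure (\<nu> j) (A i))"
      using linear_combination_eq_0[OF inv null zero, of "A i"] by simp
    also have "\<dots> = (\<Sum>j\<in>J. if j = i then a j else 0)"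
      by (rule sum.cong[OF refl]) (use sep i in simp)
    also have "\<dots> = a i" using i assms(1) by simp
    finally show ?thesis by simp
  qed
  then show False using a(1) by blast
qed

end

section \<open>Ergodic measures\<close>

context invariant_prob
begin

text \<open>Ergodicity speaks of sets equal to their preimage; the saturation of \<open>B\<close> is
  such a set, of the same mass.\<close>

lemma ergodic_forward_invariant:
  assumes erg: "ergodic_measure S \<mu>" and B: "B \<in> sets \<mu>" "B \<subseteq> S -` B"
  shows "measure \<mu> B = 0 \<or> measure \<mu> B = 1"
proof -
  define E where "E = (\<Union>i. (S ^^ i) -` B \<inter> {0..<1})"
  have E: "E \<in> sets \<mu>" "S -` E \<inter> {0..<1} = E" "measure \<mu> E = measure \<mu> B"
    using saturation[OF B] by (simp_all add: E_def)
  then have "emeasure \<mu> E = 0 \<or> emeasure \<mu> E = 1" using erg by (simp add: ergodic_measure_def)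
  then show ?thesis using E(3) by (auto simp: emeasure_eq_measure)
qed

text \<open>
  On the points fixed by \<open>S ^^ m\<close> the minimum of the orbit is an invariant function, and its level
  sets are finite. If these points had positive mass, a sublevel set would carry half of it.
\<close>

lemma ergodic_nonatomic_periodic_null:
  assumes erg: "ergodic_measure S \<mu>" and na: "nonatomic_measure \<mu>"
  shows "measure \<mu> (periodic_points S) = 0"
proof -
  have pn: "measure \<mu> {x} = 0" for x by (rule nonatomic_point_null[OF na])
  have fin_null: "measure \<mu> Z = 0" if "finite Z" "Z \<subseteq> {0..<1}" for Z
  proof -
    have "{x} \<in> sets \<mu>" if "x \<in> Z" for x
      using that \<open>Z \<subseteq> {0..<1}\<close> by (intro borel_sets) auto
    then show ?thesis using finite_measure_eq_sum_singleton[of Z] that(1) pn by simp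
  qed
  have "measure \<mu> {x \<in> {0..<1}. (S ^^ m) x = x} = 0" if m: "m \<ge> 1" for m
  proof -
    let ?P = "{x \<in> {0..<1}. (S ^^ m) x = x}"
    define f where "f x = Min ((\<lambda>i. (S ^^ i) x) ` {..<m})" for x
    have f [measurable]: "f \<in> borel_measurable \<mu>"
      unfolding f_def by (intro borel_measurable_Min) auto
    have ne: "(\<lambda>i. (S ^^ i) x) ` {..<m} \<noteq> {}" for x using m by (simp add: lessThan_empty_iff)
    have fS: "f (S x) = f x" if "x \<in> ?P" for x
    proof -
      \<comment> \<open>The shift replaces index \<open>0\<close> by index \<open>m\<close>, and
        both give the point \<open>x\<close>.\<close>
      have "(\<lambda>i. (S ^^ i) (S x)) ` {..<m} = (\<lambda>i. (S ^^ i) x) ` {..<m}"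
      proof -
        have "(\<lambda>i. (S ^^ i) (S x)) ` {..<m} = (\<lambda>i. (S ^^ i) x) ` (Suc ` {..<m})"
          by (simp add: image_image funpow_swap1)
        also have "\<dots> = (\<lambda>i. (S ^^ i) x) ` {..<m}"
        proof -
          have "Suc ` {..<m} = insert m ({..<m} - {0})"
            using m by (auto simp: image_Suc_lessThan)
          moreover have "{..<m} = insert 0 ({..<m} - {0})" using m by auto
          moreover have "(S ^^ m) x = (S ^^ 0) x" using that by simp
          ultimately show ?thesis using image_insert[of "\<lambda>i. (S ^^ i) x"] by metis
        qed
        finally show ?thesis .
      qed
      then show ?thesis unfolding f_def by (rule arg_cong)
    qed
    have SP: "S x \<in> ?P" if "x \<in> ?P" for x
      using that S_space[of x] funpow_swap1[of S m x] by auto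
    let ?R = "restrict_space \<mu> ?P"
    have P [measurable]: "?P \<in> sets \<mu>" by (rule fixed_points_sets)
    interpret R: finite_measure ?R
      by (rule finite_measure_restrict_space[OF finite_measure_axioms P])
    have spR: "space ?R = ?P" by (auto simp: space_restrict_space)
    have R: "measure ?R B = measure \<mu> B" if "B \<subseteq> ?P" for B
      using that P by (intro measure_restrict_space) auto
    have "\<exists>r. measure ?R {x \<in> space ?R. f x \<le> r} = measure ?R (space ?R) / 2"
    proof (rule R.halving_level)
      show "f \<in> borel_measurable ?R" by (rule measurable_restrict_space1[OF f])
      fix r
      \<comment> \<open>The minimum \<open>r\<close> is itself an orbit point, from which
        \<open>x\<close> is reached in at most \<open>m\<close> steps. So level sets are finite and
        hence null.\<close>
      have "{x \<in> ?P. f x = r} \<subseteq> (\<lambda>i. (S ^^ i) r) ` {..m}"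
      proof
        fix x assume "x \<in> {x \<in> ?P. f x = r}"
        then have x: "(S ^^ m) x = x" "f x = r" by auto
        then obtain i where i: "i < m" "(S ^^ i) x = r"
          using Min_in[OF _ ne[of x]] by (auto simp: f_def)
        then have "(S ^^ (m - i)) r = x" using x(1) funpow_add[of "m - i" i S] by simp
        then show "x \<in> (\<lambda>i. (S ^^ i) r) ` {..m}" using i(1) by (intro image_eqI[of _ _ "m - i"]) auto
      qed
      then have "finite {x \<in> ?P. f x = r}" by (rule finite_subset) simp
      then have "measure \<mu> {x \<in> ?P. f x = r} = 0" by (rule fin_null) auto
      then show "measure ?R {x \<in> space ?R. f x = r} = 0" unfolding spR by (subst R) auto
    qed
    then obtain r where r': "measure ?R {x \<in> ?P. f x \<le> r} = measure ?R ?P / 2"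
      unfolding spR by (elim exE)
    let ?B = "{x \<in> ?P. f x \<le> r}"
    have "?B \<subseteq> ?P" by (rule Collect_restrict)
    from r' have r: "measure \<mu> ?B = measure \<mu> ?P / 2"
      unfolding R[OF \<open>?B \<subseteq> ?P\<close>] R[OF order_refl] .
    have "?B = {x \<in> space \<mu>. f x \<le> r} \<inter> ?P" by auto
    also have "\<dots> \<in> sets \<mu>"
      using borel_measurable_le[OF f borel_measurable_const] P by (rule sets.Int)
    finally have B: "?B \<in> sets \<mu>" .
    have "?B \<subseteq> S -` ?B"
    proof
      fix x assume "x \<in> ?B"
      then have "x \<in> ?P" "f x \<le> r" by auto
      then show "x \<in> S -` ?B" using SP[of x] fS[of x] by simp
    qed
    then have "measure \<mu> ?B = 0 \<or> measure \<mu> ?B = 1" by (rule ergodic_forward_invariant[OF erg B])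
    \<comment> \<open>Half of a mass at most 1 is not 1, so it must be 0.\<close>
    moreover have "measure \<mu> ?P \<le> 1" by simp
    ultimately show ?thesis using r by linarith
  qed
  then have "{x \<in> {0..<1}. (S ^^ m) x = x} \<in> null_sets \<mu>" if "m \<in> {1..}" for m
    using that by (intro null_setsI fixed_points_sets) (simp add: emeasure_eq_measure)
  then have "periodic_points S \<in> null_sets \<mu>"
    unfolding periodic_points_eq by (intro null_sets_UN' countableI_type)
  then show ?thesis by (rule measure_eq_0_null_sets)
qed

end

text \<open>
  A Hahn set of \<open>\<mu> - \<nu>\<close> maximizes this difference, and so do all its preimages and their
  unions, because the difference is invariant.
\<close>

lemma ergodic_separated:
  assumes mu: "ergodic_measure S \<mu>" and nu: "ergodic_measure S \<nu>" and ne: "\<mu> \<noteq> \<nu>"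
  shows "\<exists>A\<in>sets unit_borel. measure \<mu> A = 1 \<and> measure \<nu> A = 0"
proof -
  interpret M: invariant_prob S \<mu> using mu by unfold_locales (simp add: ergodic_measure_def)
  interpret N: invariant_prob S \<nu> using nu by unfold_locales (simp add: ergodic_measure_def)
  have sets: "sets \<nu> = sets \<mu>" by (simp add: M.sets_eq N.sets_eq)
  define d where "d X = measure \<mu> X - measure \<nu> X" for X
  have d_Un: "d (X \<union> Y) = d X + d Y" if "X \<in> sets \<mu>" "Y \<in> sets \<mu>" "X \<inter> Y = {}" for X Y
    using that M.finite_measure_Union[of X Y] N.finite_measure_Union[of X Y] by (simp add: d_def sets)
  obtain Y where Y: "Y \<in> sets \<mu>" "\<And>X. X \<in> sets \<mu> \<Longrightarrow> X \<subseteq> Y \<Longrightarrow> 0 \<le> d X"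
    "\<And>X. X \<in> sets \<mu> \<Longrightarrow> X \<inter> Y = {} \<Longrightarrow> d X \<le> 0"
    using finite_unsigned_Hahn_decomposition[OF M.finite_measure_axioms N.finite_measure_axioms sets]
    by (auto simp: M.emeasure_eq_measure N.emeasure_eq_measure d_def)
  have max: "d X \<le> d Y" if X: "X \<in> sets \<mu>" for X
  proof -
    have "d X = d (X \<inter> Y) + d (X - Y)" using d_Un[of "X \<inter> Y" "X - Y"] X Y(1) by (simp add: Int_Diff_Un Int_Diff_disjoint)
    moreover have "d Y = d (Y \<inter> X) + d (Y - X)"
      using d_Un[of "Y \<inter> X" "Y - X"] X Y(1) by (simp add: Int_Diff_Un Int_Diff_disjoint)
    moreover have "d (X - Y) \<le> 0" by (rule Y(3)) (use X Y(1) in auto)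
    moreover have "0 \<le> d (Y - X)" by (rule Y(2)) (use X Y(1) in auto)
    ultimately show ?thesis by (simp add: Int_commute)
  qed
  \<comment> \<open>If \<open>d\<close> were never positive, complementation and
    \<open>d {0..<1} = 0\<close> would make it vanish on all sets.\<close>
  have pos: "d Y > 0"
  proof (rule ccontr)
    assume "\<not> d Y > 0"
    then have le: "d X \<le> 0" if "X \<in> sets \<mu>" for X using max[OF that] by simp
    have "d X = 0" if X: "X \<in> sets \<mu>" for X
    proof -
      have "d {0..<1} = d X + d ({0..<1} - X)"
        using d_Un[of X "{0..<1} - X"] X sets.compl_sets[OF X] sets.sets_into_space[OF X]
        by (simp add: Un_absorb1)
      moreover have "d {0..<1} = 0" using M.prob_space N.prob_space by (simp add: d_def)
      ultimately show ?thesis using le[OF X] le[OF sets.compl_sets[OF X]] by simp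
    qed
    then have "\<mu> = \<nu>"
      by (intro measure_eqI) (auto simp: sets d_def M.emeasure_eq_measure N.emeasure_eq_measure)
    then show False using ne by simp
  qed
  define B where "B m = (\<Union>i\<le>m. (S ^^ i) -` Y \<inter> {0..<1})" for m
  have Bs: "B m \<in> sets \<mu>" for m
    unfolding B_def using M.preimage_funpow_sets[OF Y(1)] by (intro sets.finite_UN) auto
  have d_pre: "d ((S ^^ i) -` Y \<inter> {0..<1}) = d Y" for i
    using M.measure_preimage_funpow[OF Y(1)] N.measure_preimage_funpow[of Y] Y(1) by (simp add: d_def sets)
  have d_B: "d (B m) = d Y" for m
  proof (induction m)
    case 0
    then show ?case using d_pre[of 0] by (simp add: B_def)
  next
    case (Suc m)
    \<comment> \<open>Adding \<open>C\<close> changes \<open>d\<close> by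
      \<open>d C - d (C \<inter> B m)\<close>, which is nonnegative because \<open>d C\<close> is
      the maximum; and \<open>d\<close> cannot exceed that maximum.\<close>
    define C where "C = (S ^^ Suc m) -` Y \<inter> {0..<1}"
    have C: "C \<in> sets \<mu>" unfolding C_def by (rule M.preimage_funpow_sets[OF Y(1)])
    have "B (Suc m) = B m \<union> C" unfolding B_def C_def atMost_Suc by blast
    also have "d \<dots> = d (B m) + d (C - B m)"
      using d_Un[of "B m" "C - B m"] Bs[of m] C by simp
    finally have 1: "d (B (Suc m)) = d Y + d (C - B m)" using Suc by simp
    have "d C = d (C \<inter> B m) + d (C - B m)"
      using d_Un[of "C \<inter> B m" "C - B m"] Bs[of m] C by (simp add: Int_Diff_Un Int_Diff_disjoint)
    then have "0 \<le> d (C - B m)" using d_pre[of "Suc m", folded C_def] max[of "C \<inter> B m"] Bs[of m] C by simp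
    then show ?case using 1 max[OF Bs[of "Suc m"]] by simp
  qed
  define E where "E = (\<Union>m. B m)"
  have E: "E \<in> sets \<mu>" unfolding E_def using Bs by auto
  have inc: "incseq B" unfolding B_def by (rule incseq_SucI) (auto simp: atMost_Suc)
  have "(\<lambda>m. d (B m)) \<longlonglongrightarrow> d E"
    unfolding d_def E_def
    by (intro tendsto_diff M.finite_Lim_measure_incseq N.finite_Lim_measure_incseq inc) (use Bs sets in auto)
  then have dE: "d E = d Y" by (simp add: d_B LIMSEQ_const_iff)
  have E_iff: "x \<in> E \<longleftrightarrow> x \<in> {0..<1} \<and> (\<exists>i. (S ^^ i) x \<in> Y)" for x
    unfolding E_def B_def by auto
  \<comment> \<open>\<open>E\<close> contains its own preimage, so it is the complement that is
    forward invariant and has mass 0 or 1.\<close>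
  define A where "A = {0..<1} - E"
  have A: "A \<in> sets \<mu>" using sets.compl_sets[OF E] by (simp add: A_def)
  have "A \<subseteq> S -` A"
  proof
    fix x assume x: "x \<in> A"
    have "S x \<in> {0..<1}" using x M.S_space[of x] by (simp add: A_def)
    moreover have "(S ^^ i) (S x) \<notin> Y" for i
      using x E_iff[of x] funpow_swap1[of S i x] funpow.simps(2)[of i S] unfolding A_def
      by (metis Diff_iff comp_apply)
    ultimately show "x \<in> S -` A" by (simp add: A_def E_iff)
  qed
  then have A01: "measure \<mu> A = 0 \<or> measure \<mu> A = 1" "measure \<nu> A = 0 \<or> measure \<nu> A = 1"
    using M.ergodic_forward_invariant[OF mu A] N.ergodic_forward_invariant[OF nu, of A] A sets by auto
  have "measure \<mu> A = 1 - measure \<mu> E" "measure \<nu> A = 1 - measure \<nu> E"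
    using M.prob_compl[OF E] N.prob_compl[of E] E by (simp_all add: A_def sets)
  then have "measure \<mu> E = 1 \<and> measure \<nu> E = 0"
    using A01 dE pos unfolding d_def by linarith
  then show ?thesis using E M.sets_eq by auto
qed

section \<open>Finiteness of the set of non-atomic ergodic measures\<close>

context interval_translation
begin

text \<open>Pairwise separation gives sets \<open>A \<mu> \<nu>\<close>; intersecting over
  \<open>\<nu>\<close> yields one set per measure, as \<open>card_separated_measures_le\<close>
  requires. That excludes \<open>Suc n\<close> such measures.\<close>

lemma finite_nonatomic_ergodic_measures: "finite (nonatomic_ergodic_measures S)"
proof (rule ccontr)
  assume "\<not> finite (nonatomic_ergodic_measures S)"
  then obtain J where J: "finite J" "card J = Suc n" "J \<subseteq> nonatomic_ergodic_measures S"
    using infinite_arbitrarily_large by blast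
  have erg: "ergodic_measure S \<mu>" "nonatomic_measure \<mu>" if "\<mu> \<in> J" for \<mu>
    using J(3) that by (auto simp: nonatomic_ergodic_measures_def)
  have ip: "invariant_prob S \<mu>" if "\<mu> \<in> J" for \<mu>
    using erg(1)[OF that] by unfold_locales (simp add: ergodic_measure_def)
  have "\<exists>A. A \<in> sets unit_borel \<and> measure \<mu> A = 1 \<and> measure \<nu> A = 0"
    if "\<mu> \<in> J" "\<nu> \<in> J" "\<mu> \<noteq> \<nu>" for \<mu> \<nu>
    using ergodic_separated[OF erg(1)[OF that(1)] erg(1)[OF that(2)] that(3)] by blast
  then obtain A where A: "\<And>\<mu> \<nu>. \<mu> \<in> J \<Longrightarrow> \<nu> \<in> J \<Longrightarrow> \<mu> \<noteq> \<nu> \<Longrightarrow>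
      A \<mu> \<nu> \<in> sets unit_borel \<and> measure \<mu> (A \<mu> \<nu>) = 1 \<and> measure \<nu> (A \<mu> \<nu>) = 0"
    by metis
  \<comment> \<open>The complement of that intersection: null for \<open>\<mu>\<close>, of full mass
    for every other member of \<open>J\<close>.\<close>
  define C where "C \<mu> = (\<Union>\<nu>\<in>J - {\<mu>}. {0..<1} - A \<mu> \<nu>)" for \<mu>
  have cs: "{0..<1} - A \<mu> \<nu> \<in> sets unit_borel" if "\<mu> \<in> J" "\<nu> \<in> J - {\<mu>}" for \<mu> \<nu>
    using A[of \<mu> \<nu>] that by (auto simp: sets_restrict_space_iff)
  have Cs: "C \<mu> \<in> sets unit_borel" if "\<mu> \<in> J" for \<mu>
    unfolding C_def using J(1) cs[OF that] by (intro sets.finite_UN) auto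
  have "card J \<le> n"
  proof (rule card_separated_measures_le[where \<nu> = "\<lambda>\<mu>. \<mu>" and A = "\<lambda>\<mu>. {0..<1} - C \<mu>"])
    fix \<mu> assume mu: "\<mu> \<in> J"
    interpret M: invariant_prob S \<mu> by (rule ip[OF mu])
    show "invariant_measure S \<mu>" by (rule M.inv)
    show "measure \<mu> (periodic_points S) = 0"
      by (rule M.ergodic_nonatomic_periodic_null[OF erg[OF mu]])
    show "{0..<1} - C \<mu> \<in> sets unit_borel"
      using sets.compl_sets[of "C \<mu>" \<mu>] Cs[OF mu] by (simp add: M.sets_eq)
  next
    fix \<mu> \<nu> assume mu: "\<mu> \<in> J" and nu: "\<nu> \<in> J"
    interpret M: invariant_prob S \<mu> by (rule ip[OF mu])
    have Cs': "C \<nu> \<in> sets \<mu>" using Cs[OF nu] M.sets_eq by simp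
    have compl: "measure \<mu> ({0..<1} - C \<nu>) = 1 - measure \<mu> (C \<nu>)"
      using M.prob_compl[OF Cs'] by simp
    have cA: "measure \<mu> ({0..<1} - A \<nu> \<rho>) = 1 - measure \<mu> (A \<nu> \<rho>)" if "\<rho> \<in> J - {\<nu>}" for \<rho>
      using M.prob_compl[of "A \<nu> \<rho>"] A[of \<nu> \<rho>] nu that M.sets_eq by auto
    show "measure \<mu> ({0..<1} - C \<nu>) = (if \<mu> = \<nu> then 1 else 0)"
    proof (cases "\<mu> = \<nu>")
      case True
      have "measure \<mu> (C \<nu>) \<le> (\<Sum>\<rho>\<in>J - {\<nu>}. measure \<mu> ({0..<1} - A \<nu> \<rho>))"
        unfolding C_def using J(1) cs[OF nu] M.sets_eq
        by (intro M.finite_measure_subadditive_finite) auto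
      also have "\<dots> = 0"
        by (rule sum.neutral) (use cA A nu True in auto)
      finally have "measure \<mu> (C \<nu>) = 0" by (simp add: antisym)
      then show ?thesis using compl True by simp
    next
      case False
      then have mem: "\<mu> \<in> J - {\<nu>}" using mu by simp
      have "measure \<mu> ({0..<1} - A \<nu> \<mu>) = 1" using cA[OF mem] A[OF nu mu] False by simp
      moreover have "measure \<mu> ({0..<1} - A \<nu> \<mu>) \<le> measure \<mu> (C \<nu>)"
        by (rule M.finite_measure_mono[OF _ Cs']) (use mem in \<open>auto simp: C_def\<close>)
      ultimately have "measure \<mu> (C \<nu>) = 1" using M.prob_le_1[of "C \<nu>"] by simp
      then show ?thesis using compl False by simp
    qed
  qed (rule J(1))
  then show False using J(2) by simp
qed

end

section \<open>Ergodic components and supports\<close>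

context interval_translation
begin

text \<open>The parts need not cover \<open>A\<close>, so the notion passes to larger sets. Its
  negation bounds how often \<open>A\<close> can still be divided; for \<open>m = 0\<close> it
  always holds.\<close>

definition splits_into :: "real measure \<Rightarrow> real set \<Rightarrow> nat \<Rightarrow> bool" where
  "splits_into \<mu> A m \<longleftrightarrow>
     (\<exists>D. (\<forall>i<m. D i \<in> sets \<mu> \<and> S -` D i \<inter> {0..<1} = D i \<and> D i \<subseteq> A \<and> measure \<mu> (D i) > 0) \<and>
          disjoint_family_on D {..<m})"

lemma splits_into_add:
  assumes "splits_into \<mu> X m"
    and Y: "Y \<in> sets \<mu>" "S -` Y \<inter> {0..<1} = Y" "measure \<mu> Y > 0"
    and "X \<inter> Y = {}" "X \<union> Y \<subseteq> A"
  shows "splits_into \<mu> A (Suc m)"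
proof -
  obtain D where D: "\<And>i. i < m \<Longrightarrow> D i \<in> sets \<mu> \<and> S -` D i \<inter> {0..<1} = D i \<and> D i \<subseteq> X \<and> measure \<mu> (D i) > 0"
    "disjoint_family_on D {..<m}"
    using assms(1) by (auto simp: splits_into_def)
  let ?D = "\<lambda>i. if i < m then D i else Y"
  have "D i \<subseteq> A" if "i < m" for i using D(1)[OF that] assms(6) by blast
  moreover have "Y \<subseteq> A" using assms(6) by blast
  ultimately have "\<forall>i<Suc m. ?D i \<in> sets \<mu> \<and> S -` ?D i \<inter> {0..<1} = ?D i \<and> ?D i \<subseteq> A \<and> measure \<mu> (?D i) > 0"
    using D(1) Y by simp
  moreover have disj: "?D i \<inter> ?D j = {}" if "i < j" "j < Suc m" for i j
  proof (cases "j < m")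
    case True
    then show ?thesis using D(2) that by (auto simp: disjoint_family_on_def)
  next
    case False
    then show ?thesis using D(1)[of i] that assms(5) by auto
  qed
  have "disjoint_family_on ?D {..<Suc m}"
    unfolding disjoint_family_on_def
  proof (intro ballI impI)
    fix i j assume "i \<in> {..<Suc m}" "j \<in> {..<Suc m}" "i \<noteq> j"
    then consider "i < j" "j < Suc m" | "j < i" "i < Suc m" by (auto simp: neq_iff)
    then show "?D i \<inter> ?D j = {}" using disj[of i j] disj[of j i] by cases (simp_all only: Int_commute)
  qed
  ultimately show ?thesis unfolding splits_into_def by (intro exI[of _ ?D] conjI)
qed

text \<open>Conditioning \<open>\<mu>\<close> on the parts gives invariant probability measures that
  the parts themselves separate.\<close>

lemma splits_into_le:
  assumes inv: "invariant_measure S \<mu>" and null: "measure \<mu> (A \<inter> periodic_points S) = 0"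
    and A: "A \<in> sets \<mu>" and split: "splits_into \<mu> A m"
  shows "m \<le> n"
proof -
  interpret invariant_prob S \<mu> using inv by unfold_locales
  obtain D where D': "\<forall>i<m. D i \<in> sets \<mu> \<and> S -` D i \<inter> {0..<1} = D i \<and> D i \<subseteq> A \<and> measure \<mu> (D i) > 0"
    and disj: "disjoint_family_on D {..<m}"
    using split unfolding splits_into_def by (elim exE conjE)
  from D' have D: "D i \<in> sets \<mu>" "S -` D i \<inter> {0..<1} = D i" "D i \<subseteq> A" "measure \<mu> (D i) > 0"
    if "i < m" for i
    using that by simp_all
  have "card {..<m} \<le> n"
  proof (rule card_separated_measures_le[where \<nu> = "\<lambda>i. uniform_measure \<mu> (D i)" and A = D])
    fix i assume "i \<in> {..<m}"
    then have i: "i < m" by simp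
    show "invariant_measure S (uniform_measure \<mu> (D i))"
      by (rule uniform_measure_invariant(1)[OF D(1,2,4)[OF i]])
    have "measure \<mu> (D i \<inter> periodic_points S) \<le> measure \<mu> (A \<inter> periodic_points S)"
      using D(3)[OF i] A periodic_points_sets by (intro finite_measure_mono sets.Int) auto
    then have "measure \<mu> (D i \<inter> periodic_points S) = 0" using null by (simp add: antisym)
    then show "measure (uniform_measure \<mu> (D i)) (periodic_points S) = 0"
      by (simp add: uniform_measure_invariant(2)[OF D(1,2,4)[OF i] periodic_points_sets])
    show "D i \<in> sets unit_borel" using D(1)[OF i] sets_eq by simp
  next
    fix i j assume "i \<in> {..<m}" "j \<in> {..<m}"
    then have ij: "i < m" "j < m" by auto
    have "D i \<inter> D j = {}" if "i \<noteq> j"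
      using disj ij that by (auto simp: disjoint_family_on_def)
    then show "measure (uniform_measure \<mu> (D i)) (D j) = (if i = j then 1 else 0)"
      using uniform_measure_invariant(2)[OF D(1,2,4)[OF ij(1)] D(1)[OF ij(2)]] D(4)[OF ij(1)] by auto
  qed simp
  then show ?thesis by simp
qed

text \<open>If \<open>A\<close> can be divided into \<open>B\<close> and \<open>A - B\<close>, one
  of the two still meets \<open>U\<close> in positive measure, and by \<open>splits_into_add\<close>
  both have a smaller bound. The base case is vacuous.\<close>

lemma exists_indecomposable:
  assumes inv: "invariant_measure S \<mu>" and U: "U \<in> sets \<mu>"
    and A: "A \<in> sets \<mu>" "S -` A \<inter> {0..<1} = A" "measure \<mu> (A \<inter> U) > 0"
    and split: "\<not> splits_into \<mu> A m"
  shows "\<exists>E\<in>sets \<mu>. E \<subseteq> A \<and> S -` E \<inter> {0..<1} = E \<and> measure \<mu> (E \<inter> U) > 0 \<and>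
    (\<forall>B\<in>sets \<mu>. S -` B \<inter> {0..<1} = B \<longrightarrow> B \<subseteq> E \<longrightarrow> measure \<mu> B = 0 \<or> measure \<mu> (E - B) = 0)"
  using A split
proof (induction m arbitrary: A)
  case 0
  then show ?case by (auto simp: splits_into_def disjoint_family_on_def)
next
  case (Suc m)
  interpret invariant_prob S \<mu> using inv by unfold_locales
  show ?case
  proof (cases "\<forall>B\<in>sets \<mu>. S -` B \<inter> {0..<1} = B \<longrightarrow> B \<subseteq> A \<longrightarrow> measure \<mu> B = 0 \<or> measure \<mu> (A - B) = 0")
    case True
    then show ?thesis using Suc.prems by blast
  next
    case False
    then obtain B where B: "B \<in> sets \<mu>" "S -` B \<inter> {0..<1} = B" "B \<subseteq> A"
      "measure \<mu> B > 0" "measure \<mu> (A - B) > 0"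
      by (auto simp: zero_less_measure_iff)
    have "S -` (A - B) \<inter> {0..<1} = (S -` A \<inter> {0..<1}) - (S -` B \<inter> {0..<1})" by blast
    then have AB: "A - B \<in> sets \<mu>" "S -` (A - B) \<inter> {0..<1} = A - B"
      using B(1,2) Suc.prems(1,2) by auto
    have "A \<inter> U = (B \<inter> U) \<union> ((A - B) \<inter> U)" using B(3) by blast
    also have "measure \<mu> \<dots> \<le> measure \<mu> (B \<inter> U) + measure \<mu> ((A - B) \<inter> U)"
      using B(1) AB(1) U by (intro measure_Un_le) auto
    finally have "measure \<mu> (B \<inter> U) > 0 \<or> measure \<mu> ((A - B) \<inter> U) > 0"
      using Suc.prems(3) by linarith
    moreover have "\<not> splits_into \<mu> B m"
      using splits_into_add[of \<mu> B m "A - B" A] AB B Suc.prems(4) by blast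
    moreover have "\<not> splits_into \<mu> (A - B) m"
      using splits_into_add[of \<mu> "A - B" m B A] AB B Suc.prems(4) by blast
    ultimately obtain X where X: "X = B \<or> X = A - B" "measure \<mu> (X \<inter> U) > 0"
        "\<not> splits_into \<mu> X m"
      by blast
    have X': "X \<in> sets \<mu>" "S -` X \<inter> {0..<1} = X" "X \<subseteq> A"
      using X(1) B(1-3) AB by (elim disjE; simp)+
    obtain E where "E \<in> sets \<mu>" "E \<subseteq> X" "S -` E \<inter> {0..<1} = E" "measure \<mu> (E \<inter> U) > 0"
      "\<forall>B\<in>sets \<mu>. S -` B \<inter> {0..<1} = B \<longrightarrow> B \<subseteq> E \<longrightarrow> measure \<mu> B = 0 \<or> measure \<mu> (E - B) = 0"
      using Suc.IH[OF X'(1,2) X(2,3)] by (elim bexE conjE)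
    then show ?thesis using subset_trans[OF \<open>E \<subseteq> X\<close> X'(3)] by (intro bexI[of _ E] conjI)
  qed
qed

text \<open>Conditioning on an indecomposable invariant set makes the measure ergodic, and the
  absence of mass on periodic points makes it non-atomic.\<close>

lemma exists_nonatomic_ergodic:
  assumes inv: "invariant_measure S \<mu>" and U: "U \<in> sets \<mu>"
    and A: "A \<in> sets \<mu>" "S -` A \<inter> {0..<1} = A" "measure \<mu> (A \<inter> U) > 0"
    and null: "measure \<mu> (A \<inter> periodic_points S) = 0"
  shows "\<exists>\<nu>\<in>nonatomic_ergodic_measures S. emeasure \<nu> U > 0"
proof -
  interpret invariant_prob S \<mu> using inv by unfold_locales
  have "\<not> splits_into \<mu> A (Suc n)" using splits_into_le[OF inv null A(1), of "Suc n"] by auto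
  from exists_indecomposable[OF inv U A this]
  obtain E where E: "E \<in> sets \<mu>" "E \<subseteq> A" "S -` E \<inter> {0..<1} = E" "measure \<mu> (E \<inter> U) > 0"
    and ind: "\<forall>B\<in>sets \<mu>. S -` B \<inter> {0..<1} = B \<longrightarrow> B \<subseteq> E \<longrightarrow>
      measure \<mu> B = 0 \<or> measure \<mu> (E - B) = 0"
    by (elim bexE conjE)
  have "measure \<mu> (E \<inter> U) \<le> measure \<mu> E" using E(1) by (intro finite_measure_mono) auto
  then have pos: "measure \<mu> E > 0" using E(4) by simp
  let ?\<nu> = "uniform_measure \<mu> E"
  have inv': "invariant_measure S ?\<nu>" by (rule uniform_measure_invariant(1)[OF E(1,3) pos])
  have meas: "measure ?\<nu> B = measure \<mu> (E \<inter> B) / measure \<mu> E" if "B \<in> sets \<mu>" for B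
    by (rule uniform_measure_invariant(2)[OF E(1,3) pos that])
  interpret N: invariant_prob S ?\<nu> using inv' by unfold_locales
  have "ergodic_measure S ?\<nu>"
    unfolding ergodic_measure_def
  proof (intro conjI inv' ballI impI)
    fix B assume "B \<in> sets ?\<nu>" "S -` B \<inter> space ?\<nu> = B"
    then have B: "B \<in> sets \<mu>" "S -` B \<inter> {0..<1} = B" by auto
    then have "S -` (E \<inter> B) \<inter> {0..<1} = E \<inter> B" using E(3) by blast
    then have "measure \<mu> (E \<inter> B) = 0 \<or> measure \<mu> (E - E \<inter> B) = 0"
      using ind[rule_format, of "E \<inter> B"] E(1) B(1) by auto
    moreover have "measure \<mu> (E - E \<inter> B) = measure \<mu> E - measure \<mu> (E \<inter> B)"
      using E(1) B(1) by (intro finite_measure_Diff) auto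
    ultimately have "measure ?\<nu> B = 0 \<or> measure ?\<nu> B = 1" using meas[OF B(1)] pos by auto
    then show "emeasure ?\<nu> B = 0 \<or> emeasure ?\<nu> B = 1" by (auto simp: N.emeasure_eq_measure)
  qed
  moreover have "nonatomic_measure ?\<nu>"
  proof (rule N.nonatomic)
    have "measure \<mu> (E \<inter> periodic_points S) \<le> measure \<mu> (A \<inter> periodic_points S)"
      using E(2) A(1) periodic_points_sets by (intro finite_measure_mono sets.Int) auto
    then have "measure \<mu> (E \<inter> periodic_points S) = 0" using null by (simp add: antisym)
    then show "measure ?\<nu> (periodic_points S) = 0" by (simp add: meas[OF periodic_points_sets])
  qed
  moreover have "emeasure ?\<nu> U > 0" using meas[OF U] E(4) pos by (simp add: N.emeasure_eq_measure)
  ultimately show ?thesis by (auto simp: nonatomic_ergodic_measures_def)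
qed

section \<open>Positivity of the maximal measures and comparison of supports\<close>

lemma maximal_nonatomic_measure_pos:
  assumes "\<nu> \<in> nonatomic_ergodic_measures S" "emeasure \<nu> U > 0" "U \<in> sets unit_borel"
  shows "emeasure (maximal_nonatomic_measure S) U > 0"
proof -
  \<comment> \<open>Finiteness is essential here: a sum over an infinite set is 0 by
    convention.\<close>
  have "emeasure \<nu> U \<le> (\<Sum>\<mu>\<in>nonatomic_ergodic_measures S. emeasure \<mu> U)"
    by (rule member_le_sum[OF assms(1)]) (simp_all add: finite_nonatomic_ergodic_measures)
  with assms(2) have "(\<Sum>\<mu>\<in>nonatomic_ergodic_measures S. emeasure \<mu> U) > 0"
    by (rule less_le_trans)
  then show ?thesis
    unfolding emeasure_maximal_nonatomic_measure[OF assms(3)] ennreal_zero_less_divide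
    by (simp add: of_nat_less_top)
qed

text \<open>A rigid segment starts at \<open>x\<close>, so a short interval
  \<open>{x..<x + r}\<close> lies both in it and in \<open>U\<close>.\<close>

lemma periodic_measure_pos:
  assumes x: "x \<in> periodic_points S" "x \<in> U" and U: "open U"
  shows "emeasure (periodic_measure S) (U \<inter> {0..<1}) > 0"
proof -
  let ?L = "restrict_space lborel {0..<1::real}" and ?R = "\<Union>{J. rigid_segment S J}"
  obtain e where e: "e > 0" "rigid_segment S {x..<x + e}" using periodic_rigid[OF x(1)] .
  obtain d where d: "d > 0" "ball x d \<subseteq> U" using U x(2) open_contains_ball by blast
  define r where "r = min e d"
  have r: "r > 0" "r \<le> e" "r \<le> d" using e(1) d(1) by (auto simp: r_def)
  have R01: "?R \<subseteq> {0..<1}" by (auto simp: rigid_segment_def)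
  have setsL: "B \<in> sets ?L \<longleftrightarrow> B \<in> sets borel \<and> B \<subseteq> {0..<1}" for B
    by (auto simp: sets_restrict_space_iff)
  have R: "?R \<in> sets ?L" unfolding setsL using R01 Union_rigid_segments_borel by blast
  have UL: "U \<inter> {0..<1} \<in> sets ?L" unfolding setsL using U by auto
  have em: "emeasure ?L B = emeasure lborel B" if "B \<subseteq> {0..<1}" for B
    using that by (simp add: emeasure_restrict_space)
  have "{x..<x + r} \<subseteq> ball x d" using r by (auto simp: dist_real_def)
  moreover have "{x..<x + r} \<subseteq> {x..<x + e}" using r by auto
  ultimately have sub: "{x..<x + r} \<subseteq> ?R \<inter> (U \<inter> {0..<1})" using d(2) e(2) R01 by blast
  have "0 < emeasure lborel {x..<x + r}" using r(1) by simp
  also have "\<dots> = emeasure ?L {x..<x + r}" using sub R01 by (intro em[symmetric]) blast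
  also have "\<dots> \<le> emeasure ?L (?R \<inter> (U \<inter> {0..<1}))"
    using sub R UL by (intro emeasure_mono) auto
  finally have pos: "emeasure ?L (?R \<inter> (U \<inter> {0..<1})) > 0" .
  \<comment> \<open>The normalizing denominator must be finite for the quotient in
    \<open>ennreal\<close> to be positive.\<close>
  have "emeasure ?L ?R = emeasure lborel ?R" by (rule em[OF R01])
  also have "\<dots> \<le> emeasure lborel {0..<1::real}" by (rule emeasure_mono[OF R01]) simp
  also have "\<dots> < top" by simp
  finally have fin: "emeasure ?L ?R < top" .
  have "periodic_measure S = uniform_measure ?L ?R" using e(2) by (auto simp: periodic_measure_def)
  then show ?thesis using emeasure_uniform_measure[OF R UL] pos fin
    by (simp add: ennreal_zero_less_divide)
qed

lemma support_subset_nonatomic: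
  assumes inv: "invariant_measure S \<mu>" and null: "measure \<mu> (periodic_points S) = 0"
  shows "measure_support \<mu> \<subseteq> measure_support (maximal_nonatomic_measure S)"
proof
  interpret invariant_prob S \<mu> using inv by unfold_locales
  fix x assume x: "x \<in> measure_support \<mu>"
  have sp: "space (maximal_nonatomic_measure S) = {0..<1}"
    by (rule space_eq_if_sets_unit_borel) simp
  show "x \<in> measure_support (maximal_nonatomic_measure S)"
    unfolding measure_support_def sp
  proof (intro CollectI conjI allI impI)
    show "x \<in> {0..<1}" using x by (simp add: measure_support_def)
    fix U assume U: "open U" "x \<in> U"
    let ?U = "U \<inter> {0..<1}"
    have Us: "?U \<in> sets \<mu>" using U(1) by (intro Int_sets) auto
    have "emeasure \<mu> ?U > 0" using x U by (simp add: measure_support_def)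
    then have pos: "measure \<mu> ({0..<1} \<inter> ?U) > 0" by (simp add: emeasure_eq_measure Int_absorb1)
    have full: "{0..<1} \<in> sets \<mu>" "S -` {0..<1} \<inter> {0..<1} = {0..<1}"
      using sets.top[of \<mu>] S_space by auto
    have "measure \<mu> ({0..<1} \<inter> periodic_points S) = 0"
      using null sets.Int_space_eq1[OF periodic_points_sets] by simp
    from exists_nonatomic_ergodic[OF inv Us full pos this]
    obtain \<nu> where "\<nu> \<in> nonatomic_ergodic_measures S" "emeasure \<nu> ?U > 0" by (elim bexE)
    then show "emeasure (maximal_nonatomic_measure S) ?U > 0"
      by (rule maximal_nonatomic_measure_pos) (use Us sets_eq in simp)
  qed
qed

text \<open>An open set meeting the periodic points is charged by \<open>periodic_measure\<close>.
  Otherwise its mass lies, up to a null set, in an invariant set free of periodic points, and a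
  non-atomic ergodic measure charges it.\<close>

lemma support_subset_maximal:
  assumes inv: "invariant_measure S \<mu>"
  shows "measure_support \<mu> \<subseteq> measure_support (maximal_measure S)"
proof (cases "periodic_points S = {}")
  case True
  then show ?thesis using support_subset_nonatomic[OF inv] by (simp add: maximal_measure_def)
next
  case False
  interpret invariant_prob S \<mu> using inv by unfold_locales
  have sp: "space (maximal_measure S) = {0..<1}"
    by (rule space_eq_if_sets_unit_borel) simp
  show ?thesis
  proof
    fix x assume x: "x \<in> measure_support \<mu>"
    show "x \<in> measure_support (maximal_measure S)"
      unfolding measure_support_def sp
    proof (intro CollectI conjI allI impI)
      show "x \<in> {0..<1}" using x by (simp add: measure_support_def)
      fix U assume U: "open U" "x \<in> U"
      let ?U = "U \<inter> {0..<1}"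
      have Us: "?U \<in> sets \<mu>" using U(1) by (intro Int_sets) auto
      have Upos: "measure \<mu> ?U > 0" using x U by (simp add: measure_support_def emeasure_eq_measure)
      have "emeasure (maximal_nonatomic_measure S) ?U > 0 \<or> emeasure (periodic_measure S) ?U > 0"
      proof (cases "U \<inter> periodic_points S = {}")
        case False
        then show ?thesis using periodic_measure_pos U(1) by blast
      next
        case empty: True
        let ?P = "periodic_points S"
        \<comment> \<open>The periodic points are only forward invariant; their saturation has an
          invariant complement.\<close>
        define E where "E = (\<Union>i. (S ^^ i) -` ?P \<inter> {0..<1})"
        have fwd: "?P \<subseteq> S -` ?P"
        proof
          fix y assume "y \<in> ?P"
          then obtain m where m: "y \<in> {0..<1}" "m \<ge> 1" "(S ^^ m) y = y" by (auto simp: periodic_points_def)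
          then have "(S ^^ m) (S y) = S y" using funpow_swap1[of S m y] by simp
          then show "y \<in> S -` ?P" using S_space[OF m(1)] m(2) by (auto simp: periodic_points_def)
        qed
        have E: "E \<in> sets \<mu>" "?P \<subseteq> E" "S -` E \<inter> {0..<1} = E" "measure \<mu> E = measure \<mu> ?P"
          using saturation[OF periodic_points_sets fwd] by (simp_all add: E_def)
        let ?A = "{0..<1} - E"
        have A: "?A \<in> sets \<mu>" using sets.compl_sets[OF E(1)] by simp
        have A_inv: "S -` ?A \<inter> {0..<1} = ?A" using E(3) S_space by auto
        \<comment> \<open>\<open>U\<close> misses the periodic points, and \<open>E\<close> exceeds
          them by a null set.\<close>
        have "measure \<mu> (?U \<inter> E) \<le> measure \<mu> (E - ?P)"
          using empty Us E(1) by (intro finite_measure_mono) auto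
        also have "\<dots> = 0" using finite_measure_Diff[OF E(1) periodic_points_sets E(2)] E(4) by simp
        finally have "measure \<mu> (?U \<inter> E) = 0" by (simp add: antisym)
        moreover have "measure \<mu> ?U = measure \<mu> (?A \<inter> ?U) + measure \<mu> (?U \<inter> E)"
        proof -
          have "measure \<mu> ((?A \<inter> ?U) \<union> (?U \<inter> E)) = measure \<mu> (?A \<inter> ?U) + measure \<mu> (?U \<inter> E)"
            by (rule finite_measure_Union[OF sets.Int[OF A Us] sets.Int[OF Us E(1)]]) blast
          moreover have "(?A \<inter> ?U) \<union> (?U \<inter> E) = ?U" by blast
          ultimately show ?thesis by simp
        qed
        ultimately have pos: "measure \<mu> (?A \<inter> ?U) > 0" using Upos by simp
        have AP: "measure \<mu> (?A \<inter> ?P) = 0"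
        proof -
          have "?A \<inter> ?P = {}" using E(2) by blast
          then show ?thesis by (simp only: measure_empty)
        qed
        obtain \<nu> where nu: "\<nu> \<in> nonatomic_ergodic_measures S" "emeasure \<nu> ?U > 0"
          using exists_nonatomic_ergodic[OF inv Us A A_inv pos AP] by (elim bexE)
        have "emeasure (maximal_nonatomic_measure S) ?U > 0"
          by (rule maximal_nonatomic_measure_pos[OF nu]) (use Us sets_eq in simp)
        then show ?thesis by blast
      qed
      moreover have "emeasure (maximal_measure S) ?U =
          (emeasure (maximal_nonatomic_measure S) ?U + emeasure (periodic_measure S) ?U) / 2"
        using Us sets_eq False by (intro emeasure_maximal_measure) auto
      ultimately show "emeasure (maximal_measure S) ?U > 0"
        by (auto simp: ennreal_zero_less_divide add_pos_nonneg add_nonneg_pos)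
    qed
  qed
qed

end

theorem lemma1:
  fixes S :: "real \<Rightarrow> real" and n :: nat and t c :: "nat \<Rightarrow> real"
  assumes "interval_translation_map n t c S"
  shows "(\<forall>\<mu>. invariant_measure S \<mu> \<longrightarrow>
            measure_support \<mu> \<subseteq> measure_support (maximal_measure S)) \<and>
         (\<forall>\<mu>. invariant_measure S \<mu> \<longrightarrow> nonatomic_measure \<mu> \<longrightarrow>
            (AE x in \<mu>. x \<notin> periodic_points S) \<longrightarrow>
            measure_support \<mu> \<subseteq> measure_support (maximal_nonatomic_measure S))"
proof -
  interpret interval_translation n t c S by unfold_locales (rule assms)
  have "measure_support \<mu> \<subseteq> measure_support (maximal_nonatomic_measure S)"
    if inv: "invariant_measure S \<mu>" and AE: "AE x in \<mu>. x \<notin> periodic_points S" for \<mu>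
  proof -
    interpret invariant_prob S \<mu> using inv by unfold_locales
    have "periodic_points S \<in> null_sets \<mu>"
      using AE by (subst AE_iff_null_sets[OF periodic_points_sets]) auto
    then have "measure \<mu> (periodic_points S) = 0" by (rule measure_eq_0_null_sets)
    then show ?thesis by (rule support_subset_nonatomic[OF inv])
  qed
  then show ?thesis using support_subset_maximal by blast
qed

end
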